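(* Let $\mathcal{H}$ be a separable real Hilbert space (finite- or infinite-dimensional), and let $P$ and $Q$ be Borel probability measures on $\mathcal{H}$. (i) If $F_P^{\mathrm{g}}(x)=F_Q^{\mathrm{g}}(x)$ for all $x\in\mathcal{H}$, then $P=Q$. (ii) If $F_P^{\mathrm{g}}(x)=F_Q^{\mathrm{g}}(x)$ for all $x$ in a dense subset $\mathcal{D}\subset\mathcal{H}$, then $P=Q$.
   Context: For a Borel probability measure $P$ on $\mathcal{H}$ (with inner product $\langle\cdot,\cdot\rangle$ and norm $\|\cdot\|$), the spatial distribution function of $P$ is the map $$F_P^{\mathrm{g}}:\mathcal{H}\to\{x\in\mathcal{H}:\|x\|\le 1\},\qquad F_P^{\mathrm{g}}(x)=\int_{\mathcal{H}\setminus\{x\}}\frac{x-z}{\|x-z\|}\,dP(z),$$ where the $\mathcal{H}$-valued integral is defined (uniquely) through the Riesz representation theorem, i.e. $\langle F_P^{\mathrm{g}}(x),v\rangle=\int_{\mathcal{H}\setminus\{x\}}\frac{\langle x-z,v\rangle}{\|x-z\|}\,dP(z)$ for all $v\in\mathcal{H}$. No moment assumption is made on $P$ and $Q$. *)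

theory Defs
  imports "HOL-Probability.Probability"
begin

text \<open>
  A separable real Hilbert space is a type of sort
  \<open>{real_inner, banach, second_countable_topology}\<close>: for metric spaces, second countability
  is separability. The Riesz element is introduced by a definite description;
  \<open>inner_spatial_df\<close> below shows that it exists for every Borel probability measure.
\<close>

definition spatial_df ::
  "'h::{real_inner, banach, second_countable_topology} measure \<Rightarrow> 'h \<Rightarrow> 'h" where
  "spatial_df P x =
     (THE w. \<forall>v. inner w v = (LINT z:UNIV - {x}|P. inner (x - z) v / norm (x - z)))"

lemma
  fixes P :: "'h::{real_inner, banach, second_countable_topology} measure"
  assumes "prob_space P" and "sets P = sets borel"
  shows inner_spatial_df:
      "inner (spatial_df P x) v = (LINT z:UNIV - {x}|P. inner (x - z) v / norm (x - z))"
    and norm_spatial_df_le: "norm (spatial_df P x) \<le> 1"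
proof -
  interpret prob_space P by fact
  note [measurable_cong] = assms(2)
  define f where "f z = indicator (UNIV - {x}) z *\<^sub>R ((1 / norm (x - z)) *\<^sub>R (x - z))" for z
  have bound: "norm (f z) \<le> 1" for z
    by (auto simp: f_def indicator_def)
  have f_meas: "f \<in> borel_measurable P"
    unfolding f_def by measurable
  have int: "integrable P f"
    by (rule integrable_const_bound[where B = 1]) (use bound f_meas in auto)
  have riesz: "inner (integral\<^sup>L P f) v = (LINT z:UNIV - {x}|P. inner (x - z) v / norm (x - z))" for v
  proof -
    have "inner (integral\<^sup>L P f) v = (LINT z|P. inner (f z) v)"
      using int by simp
    also have "\<dots> = (LINT z:UNIV - {x}|P. inner (x - z) v / norm (x - z))"
      unfolding set_lebesgue_integral_def by (rule Bochner_Integration.integral_cong) (auto simp: f_def)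
    finally show ?thesis .
  qed
  have eq: "spatial_df P x = integral\<^sup>L P f"
    unfolding spatial_df_def
  proof (rule the_equality)
    fix w assume "\<forall>v. inner w v = (LINT z:UNIV - {x}|P. inner (x - z) v / norm (x - z))"
    then show "w = integral\<^sup>L P f"
      by (intro vector_eq_rdot[THEN iffD1]) (simp add: riesz)
  qed (simp add: riesz)
  show "inner (spatial_df P x) v = (LINT z:UNIV - {x}|P. inner (x - z) v / norm (x - z))"
    by (simp add: eq riesz)
  have "norm (integral\<^sup>L P f) \<le> (LINT z|P. norm (f z))"
    by (rule integral_norm_bound)
  also have "\<dots> \<le> (LINT z|P. 1)"
    using int bound by (intro integral_mono) auto
  finally show "norm (spatial_df P x) \<le> 1"
    by (simp add: eq prob_space)
qed

end

theory Submission
  imports Defs "HOL-Real_Asymp.Real_Asymp"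
begin

text \<open>
  Write \<open>\<mu> = P - Q\<close> and \<open>u(x, r) = \<integral> (sqrt (\<parallel>x - z\<parallel>\<^sup>2 + r\<^sup>2) - \<parallel>z\<parallel>) d\<mu>(z)\<close>.
  The spatial distribution function of \<open>P\<close> is a subgradient of the convex function
  \<open>x \<mapsto> \<integral> (\<parallel>x - z\<parallel> - \<parallel>z\<parallel>) dP(z)\<close>; two convex functions with a common bounded subgradient on a dense
  set differ by a constant, so \<open>u(x, 0) = 0\<close> for all \<open>x\<close>.

  Then \<open>u(x, r) = 0\<close> for all \<open>r \<ge> 0\<close>. In infinite dimension, replace \<open>x\<close> by \<open>x + r e\<^sub>n\<close> with \<open>e\<^sub>n\<close>
  orthonormal and let \<open>n\<close> tend to infinity. In dimension \<open>d\<close>, \<open>u\<close> solves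
  \<open>\<Delta>\<^sub>x u + \<partial>\<^sub>r\<^sup>2 u - (d / r) \<partial>\<^sub>r u = 0\<close> for \<open>r > 0\<close> and grows more slowly than the norm, which is itself a
  positive solution, so the maximum principle applies.

  Differentiating repeatedly in \<open>s = r\<^sup>2\<close> gives \<open>\<integral> (\<parallel>x - z\<parallel>\<^sup>2 + s) powr (1/2 - k) d\<mu>(z) = 0\<close> for
  \<open>k \<ge> 1\<close>, and the limit \<open>(1 + t/n) powr (1/2 - n) \<longlonglongrightarrow> exp (- t)\<close> shows that \<open>\<mu>\<close> annihilates all Gaussians.
  These are closed under multiplication, which forces \<open>\<mu> = 0\<close>.
\<close>

section \<open>The potential of a measure and its subgradient\<close>

text \<open>Integrability without moments: the subtracted \<open>norm z\<close> makes the integrand bounded in \<open>z\<close>.\<close>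

definition pot :: "'h::{real_inner, banach, second_countable_topology} measure \<Rightarrow> 'h \<times> real \<Rightarrow> real" where
  "pot M p = (LINT z|M. norm (p - (z, 0)) - norm z)"

lemma abs_kernel_le:
  fixes z :: "'h::real_inner"
  shows "\<bar>norm (p - (z, 0::real)) - norm z\<bar> \<le> norm p"
proof -
  have "norm (p - (z, 0)) \<le> norm p + norm (z, 0::real)" by (rule norm_triangle_ineq4)
  moreover have "norm (z, 0::real) \<le> norm (p - (z, 0)) + norm p"
    using norm_triangle_ineq4[of p "p - (z, 0)"] by (simp add: algebra_simps)
  ultimately show ?thesis by auto
qed

lemma kernel_measurable [measurable]:
  "(\<lambda>z::'h::{real_inner, second_countable_topology}. norm (p - (z, 0::real)) - norm z) \<in> borel_measurable borel"
  by (intro borel_measurable_continuous_onI continuous_intros)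

lemma integrable_kernel:
  assumes "prob_space M" and "sets M = sets borel"
  shows "integrable M (\<lambda>z::'h::{real_inner, second_countable_topology}. norm (p - (z, 0::real)) - norm z)"
proof -
  interpret prob_space M by fact
  note [measurable_cong] = assms(2)
  show ?thesis
    by (intro integrable_const_bound[where B = "norm p"] AE_I2) (simp_all only: real_norm_def abs_kernel_le, measurable)
qed

lemma abs_norm_diff_diff_le:
  fixes p q :: "'b::real_normed_vector"
  shows "\<bar>norm (p - c) - norm (q - c)\<bar> \<le> norm (p - q)"
  using norm_triangle_ineq3[of "p - c" "q - c"] by simp

section \<open>Test functions with equal integrals under both measures\<close>

locale borel_prob_pair =
  P: prob_space P + Q: prob_space Q
  for P Q :: "'h::{real_inner, banach, second_countable_topology} measure" +
  assumes sets_P [measurable_cong]: "sets P = sets borel"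
    and sets_Q [measurable_cong]: "sets Q = sets borel"
begin

text \<open>Integrability is part of the notion: a non-integrable function has integral 0 by
  convention, and bare equality of integrals would not pass to sums.\<close>

definition agree :: "('h \<Rightarrow> real) \<Rightarrow> bool" where
  "agree f \<longleftrightarrow> integrable P f \<and> integrable Q f \<and> integral\<^sup>L P f = integral\<^sup>L Q f"

lemma space_P [simp]: "space P = UNIV" and space_Q [simp]: "space Q = UNIV"
  using sets_eq_imp_space_eq[OF sets_P] sets_eq_imp_space_eq[OF sets_Q] by auto

lemma agree_add: "agree f \<Longrightarrow> agree g \<Longrightarrow> agree (\<lambda>z. f z + g z)"
  by (simp add: agree_def)

lemma agree_diff: "agree f \<Longrightarrow> agree g \<Longrightarrow> agree (\<lambda>z. f z - g z)"
  by (simp add: agree_def)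

lemma agree_cmult: "agree f \<Longrightarrow> agree (\<lambda>z. c * f z)"
  by (simp add: agree_def)

text \<open>Dominated convergence under both measures, with a constant majorant since the total
  masses are finite. Every later differentiation in \<open>s\<close> and every approximation of an
  indicator goes through it.\<close>

lemma agree_limit:
  assumes "\<And>n. agree (f n)" and "\<And>n z. \<bar>f n z\<bar> \<le> C" and "\<And>z. (\<lambda>n. f n z) \<longlonglongrightarrow> g z"
  shows "agree g"
proof -
  have m: "f n \<in> borel_measurable borel" for n
    using assms(1)[of n] sets_P by (auto simp: agree_def dest!: borel_measurable_integrable cong: measurable_cong_sets)
  have mg: "g \<in> borel_measurable borel"
    by (rule borel_measurable_LIMSEQ_real[OF _ m]) (use assms(3) in auto)
  note [measurable] = m mg
  have P: "integrable P g" "(\<lambda>n. integral\<^sup>L P (f n)) \<longlonglongrightarrow> integral\<^sup>L P g"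
    by (rule integrable_dominated_convergence[where w = "\<lambda>_. C" and s = f]
        integral_dominated_convergence[where w = "\<lambda>_. C"]; use assms in simp)+
  have Q: "integrable Q g" "(\<lambda>n. integral\<^sup>L Q (f n)) \<longlonglongrightarrow> integral\<^sup>L Q g"
    by (rule integrable_dominated_convergence[where w = "\<lambda>_. C" and s = f]
        integral_dominated_convergence[where w = "\<lambda>_. C"]; use assms in simp)+
  have "integral\<^sup>L P g = integral\<^sup>L Q g"
    using P(2) Q(2) assms(1) by (auto simp: agree_def intro: LIMSEQ_unique)
  with P Q show ?thesis by (simp add: agree_def)
qed

text \<open>This is \<open>u(x, r)\<close> of the overview with \<open>p = (x, r)\<close>: the
  measures sit on the hyperplane \<open>r = 0\<close> of the product space.\<close>

definition pdiff :: "'h \<times> real \<Rightarrow> real" where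
  "pdiff p = pot P p - pot Q p"

lemma prob_PQ: "prob_space P" "prob_space Q"
  by unfold_locales

lemmas integrable_kernel_PQ = integrable_kernel[OF prob_PQ(1) sets_P] integrable_kernel[OF prob_PQ(2) sets_Q]

lemma agree_kernel_iff: "agree (\<lambda>z. norm (p - (z, 0::real)) - norm z) \<longleftrightarrow> pdiff p = 0"
  by (auto simp: agree_def pdiff_def pot_def integrable_kernel_PQ)

lemma pdiff_lipschitz: "\<bar>pdiff p - pdiff q\<bar> \<le> 2 * norm (p - q)"
proof -
  have b: "\<bar>(norm (p - (z, 0)) - norm z) - (norm (q - (z, 0)) - norm z)\<bar> \<le> norm (p - q)" for z :: 'h
    using abs_norm_diff_diff_le[of p "(z, 0)" q] by simp
  have "\<bar>pot P p - pot P q\<bar> \<le> (LINT z|P. norm (p - q))"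
    unfolding pot_def Bochner_Integration.integral_diff[OF integrable_kernel_PQ(1) integrable_kernel_PQ(1), symmetric]
    by (intro order.trans[OF integral_abs_bound] integral_mono integrable_abs Bochner_Integration.integrable_diff integrable_kernel_PQ b) simp
  moreover have "\<bar>pot Q p - pot Q q\<bar> \<le> (LINT z|Q. norm (p - q))"
    unfolding pot_def Bochner_Integration.integral_diff[OF integrable_kernel_PQ(2) integrable_kernel_PQ(2), symmetric]
    by (intro order.trans[OF integral_abs_bound] integral_mono integrable_abs Bochner_Integration.integrable_diff integrable_kernel_PQ b) simp
  ultimately show ?thesis using P.prob_space Q.prob_space by (simp add: pdiff_def)
qed

lemma continuous_on_pdiff: "continuous_on A pdiff"
proof -
  have "2-lipschitz_on A pdiff"
    by (rule lipschitz_onI) (auto simp: dist_norm pdiff_lipschitz)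
  then show ?thesis by (rule lipschitz_on_continuous_on)
qed

end

section \<open>Potentials with a common subgradient on a dense set\<close>

lemma norm_subgradient:
  fixes a b :: "'a::real_inner"
  shows "inner a (b - a) / norm a \<le> norm b - norm a"
\<comment> \<open>At \<open>a = 0\<close> the quotient is 0 by the convention for division by zero,
  and 0 is a subgradient of the norm at the origin. Elsewhere this is Cauchy-Schwarz.\<close>
proof (cases "a = 0")
  case False
  have "inner a b \<le> norm a * norm b" by (rule norm_cauchy_schwarz)
  with False show ?thesis
    by (simp add: divide_simps inner_diff_right algebra_simps power2_norm_eq_inner[symmetric] power2_eq_square)
qed auto

lemma spatial_df_subgradient:
  fixes M :: "'h::{real_inner, banach, second_countable_topology} measure"
  assumes "prob_space M" and [measurable_cong]: "sets M = sets borel"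
  shows "inner (spatial_df M x) (y - x) \<le>
    (LINT z|M. norm (y - z) - norm z) - (LINT z|M. norm (x - z) - norm z)"
proof -
  interpret prob_space M by fact
  have b: "\<bar>norm (w - z) - norm z\<bar> \<le> norm w" for w z :: 'h
    using norm_triangle_ineq3[of "w - z" "- z"] by simp
  have i: "integrable M (\<lambda>z. norm (w - z) - norm z)" for w
    using b by (intro integrable_const_bound[where B = "norm w"]) auto
  have c: "\<bar>inner (x - z) v / norm (x - z)\<bar> \<le> norm v" for z v
    using Cauchy_Schwarz_ineq2[of "x - z" v] by (cases "x = z") (auto simp: divide_simps mult.commute)
  have i2: "integrable M (\<lambda>z. inner (x - z) v / norm (x - z))" for v
    using c by (intro integrable_const_bound[where B = "norm v"]) auto
  \<comment> \<open>At \<open>z = x\<close> the quotient is 0 anyway, so the excluded point can be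
    put back and \<open>norm_subgradient\<close> integrated over the whole space.\<close>
  have "inner (spatial_df M x) (y - x) = (LINT z|M. inner (x - z) (y - x) / norm (x - z))"
    unfolding inner_spatial_df[OF assms] set_lebesgue_integral_def
    by (rule Bochner_Integration.integral_cong) (auto simp: indicator_def)
  also have "\<dots> \<le> (LINT z|M. (norm (y - z) - norm z) - (norm (x - z) - norm z))"
    using norm_subgradient[of "x - z" "y - z" for z]
    by (intro integral_mono[OF i2 Bochner_Integration.integrable_diff[OF i i]]) simp
  also have "\<dots> = (LINT z|M. norm (y - z) - norm z) - (LINT z|M. norm (x - z) - norm z)"
    by (intro Bochner_Integration.integral_diff i)
  finally show ?thesis .
qed

text \<open>On a segment cut into \<open>n\<close> nearly equal steps the gap bounds almost telescope, to
  \<open>inner (F y - F x) (y - x) / n\<close>.\<close>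

lemma eq_if_monotone_gap_on_dense:
  fixes F :: "'a::real_inner \<Rightarrow> 'a" and \<psi> :: "'a \<Rightarrow> real"
  assumes D: "closure D = UNIV" and F: "\<And>x. norm (F x) \<le> 1"
    and gap: "\<And>x y. x \<in> D \<Longrightarrow> y \<in> D \<Longrightarrow> \<bar>\<psi> y - \<psi> x\<bar> \<le> inner (F y - F x) (y - x)"
    and x: "x \<in> D" and y: "y \<in> D"
  shows "\<psi> x = \<psi> y"
proof -
  have bound: "\<bar>\<psi> y - \<psi> x\<bar> \<le> (2 * norm (y - x) + 4) / real n" if n: "n > 0" for n :: nat
  proof -
    define w where "w i = x + (real i / real n) *\<^sub>R (y - x)" for i
    \<comment> \<open>The tolerance is of order \<open>1 / n^2\<close> because \<open>n\<close>
      errors accumulate and their sum must still tend to 0.\<close>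
    have "\<exists>p\<in>D. dist p (w i) < 1 / (real n)\<^sup>2" for i
      using D n by (metis UNIV_I closure_approachable of_nat_0_less_iff zero_less_divide_1_iff zero_less_power)
    then obtain p where p: "\<And>i. p i \<in> D" "\<And>i. dist (p i) (w i) < 1 / (real n)\<^sup>2" by metis
    \<comment> \<open>The end points are exactly \<open>x\<close> and \<open>y\<close>, so that the
      sums of both \<open>\<psi>\<close> and \<open>F\<close> telescope.\<close>
    define q where "q i = (if i = 0 then x else if i = n then y else p i)" for i
    have qD: "q i \<in> D" for i using x y p by (auto simp: q_def)
    have w0: "w 0 = x" "w n = y" using n by (auto simp: w_def)
    have qw: "norm (q i - w i) \<le> 1 / (real n)\<^sup>2" for i
      using p(2)[of i] w0 by (auto simp: q_def dist_norm)
    have step: "\<bar>\<psi> (q (Suc i)) - \<psi> (q i)\<bar>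
        \<le> inner (F (q (Suc i)) - F (q i)) ((1 / real n) *\<^sub>R (y - x)) + 4 / (real n)\<^sup>2" for i
    proof -
      \<comment> \<open>The deviation of the step from the ideal \<open>(y - x) / n\<close>.
        Replacing every step by this common vector lets the increments of \<open>F\<close> be summed
        inside the inner product.\<close>
      define e where "e = (q (Suc i) - q i) - (1 / real n) *\<^sub>R (y - x)"
      have "e = (q (Suc i) - w (Suc i)) - (q i - w i)"
        by (simp add: e_def w_def algebra_simps add_divide_distrib)
      then have "norm e \<le> 2 / (real n)\<^sup>2"
        using norm_triangle_ineq4[of "q (Suc i) - w (Suc i)" "q i - w i"] qw[of i] qw[of "Suc i"] by simp
      moreover have "norm (F (q (Suc i)) - F (q i)) \<le> 2"
        using norm_triangle_ineq4[of "F (q (Suc i))" "F (q i)"] F[of "q i"] F[of "q (Suc i)"] by simp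
      ultimately have "inner (F (q (Suc i)) - F (q i)) e \<le> 2 * (2 / (real n)\<^sup>2)"
        by (intro order.trans[OF norm_cauchy_schwarz] mult_mono) auto
      moreover have "q (Suc i) - q i = (1 / real n) *\<^sub>R (y - x) + e" by (simp add: e_def)
      ultimately show ?thesis
        using gap[OF qD[of i] qD[of "Suc i"]] by (simp add: inner_add_right)
    qed
    have "\<bar>\<psi> y - \<psi> x\<bar> = \<bar>\<Sum>i<n. \<psi> (q (Suc i)) - \<psi> (q i)\<bar>"
      using n sum_lessThan_telescope[of "\<lambda>i. \<psi> (q i)" n] by (simp add: q_def)
    also have "\<dots> \<le> (\<Sum>i<n. inner (F (q (Suc i)) - F (q i)) ((1 / real n) *\<^sub>R (y - x)) + 4 / (real n)\<^sup>2)"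
      by (rule order.trans[OF sum_abs sum_mono]) (use step in auto)
    also have "\<dots> = inner (\<Sum>i<n. F (q (Suc i)) - F (q i)) ((1 / real n) *\<^sub>R (y - x)) + real n * (4 / (real n)\<^sup>2)"
      by (simp add: sum.distrib inner_sum_left sum_divide_distrib)
    also have "(\<Sum>i<n. F (q (Suc i)) - F (q i)) = F y - F x"
      using n sum_lessThan_telescope[of "\<lambda>i. F (q i)" n] by (simp add: q_def)
    also have "inner (F y - F x) ((1 / real n) *\<^sub>R (y - x)) \<le> 2 * norm ((1 / real n) *\<^sub>R (y - x))"
      using norm_triangle_ineq4[of "F y" "F x"] F[of x] F[of y]
      by (intro order.trans[OF norm_cauchy_schwarz] mult_right_mono) auto
    finally show ?thesis
      using n unfolding norm_scaleR by (simp add: add_divide_distrib power2_eq_square)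
  qed
  have "(\<lambda>n. (2 * norm (y - x) + 4) / real n) \<longlonglongrightarrow> 0"
    by (rule lim_const_over_n)
  then have "\<bar>\<psi> y - \<psi> x\<bar> \<le> 0"
    by (rule LIMSEQ_le_const) (use bound in \<open>auto intro!: exI[of _ 1]\<close>)
  then show ?thesis by simp
qed

context borel_prob_pair
begin

lemma pdiff_boundary_eq_0:
  assumes D: "closure D = UNIV" and eq: "\<And>x. x \<in> D \<Longrightarrow> spatial_df P x = spatial_df Q x"
  shows "pdiff (x, 0) = 0"
proof -
  define \<psi> where "\<psi> x = pdiff (x, 0)" for x
  have pot0: "pot M (x, 0) = (LINT z|M. norm (x - z) - norm z)" for M x
    by (simp add: pot_def)
  \<comment> \<open>Let \<open>F\<close> be the common value on \<open>D\<close>. The increments of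
    both potentials from \<open>x\<close> to \<open>y\<close> lie between
    \<open>inner (F x) (y - x)\<close> and \<open>inner (F y) (y - x)\<close>, so they differ by at
    most the length of that interval.\<close>
  have gap: "\<bar>\<psi> y - \<psi> x\<bar> \<le> inner (spatial_df P y - spatial_df P x) (y - x)"
    if "x \<in> D" "y \<in> D" for x y
    using spatial_df_subgradient[OF prob_PQ(1) sets_P, of x y] spatial_df_subgradient[OF prob_PQ(1) sets_P, of y x]
      spatial_df_subgradient[OF prob_PQ(2) sets_Q, of x y] spatial_df_subgradient[OF prob_PQ(2) sets_Q, of y x]
      eq[OF that(1)] eq[OF that(2)]
    by (simp add: \<psi>_def pdiff_def pot0 inner_diff_left inner_diff_right)
  have cont: "continuous_on UNIV \<psi>"
    unfolding \<psi>_def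
    by (rule continuous_on_compose2[OF continuous_on_pdiff[of UNIV]]) (auto intro!: continuous_intros)
  obtain x0 where x0: "x0 \<in> D" using D by fastforce
  have "\<psi> x = \<psi> x0" if "x \<in> D" for x
    by (rule eq_if_monotone_gap_on_dense[OF D norm_spatial_df_le[OF prob_PQ(1) sets_P] gap that x0])
  then have "\<psi> x = \<psi> x0" for x
    using continuous_constant_on_closure[of D \<psi> "\<psi> x0" x] cont D by simp
  then have "\<psi> x = \<psi> 0" by metis
  \<comment> \<open>The subtracted \<open>norm z\<close> fixes the additive constant: at the origin
    the integrand is identically 0.\<close>
  also have "\<psi> 0 = 0" by (simp add: \<psi>_def pdiff_def pot_def)
  finally show ?thesis by (simp add: \<psi>_def)
qed

end

section \<open>Orthonormal bases and sequences\<close>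

text \<open>The type carries no dimension, so finite dimension is expressed by the existence of such
  a finite set; the last clause says that it spans.\<close>

definition orthonormal_basis :: "'a::real_inner set \<Rightarrow> bool" where
  "orthonormal_basis B \<longleftrightarrow> finite B \<and> (\<forall>a\<in>B. \<forall>b\<in>B. inner a b = (if a = b then 1 else 0)) \<and>
     (\<forall>x. (\<Sum>b\<in>B. inner x b *\<^sub>R b) = x)"

lemma orthonormal_basis_expansion: "orthonormal_basis B \<Longrightarrow> (\<Sum>b\<in>B. inner x b *\<^sub>R b) = x"
  unfolding orthonormal_basis_def by blast

lemma orthonormal_basis_norm:
  assumes "orthonormal_basis B" "b \<in> B" shows "norm b = 1" "inner b b = 1"
proof -
  show "inner b b = 1" using assms unfolding orthonormal_basis_def by metis
  then show "norm b = 1" by (simp add: norm_eq_1)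
qed

lemma orthonormal_basis_parseval:
  assumes "orthonormal_basis B" shows "(\<Sum>b\<in>B. (inner x b)\<^sup>2) = (norm x)\<^sup>2"
proof -
  have "(norm x)\<^sup>2 = inner x (\<Sum>b\<in>B. inner x b *\<^sub>R b)"
    unfolding orthonormal_basis_expansion[OF assms] by (rule power2_norm_eq_inner)
  then show ?thesis by (simp add: inner_sum_right power2_eq_square)
qed

lemma bounded_combinations_in_compact:
  fixes B :: "'a::real_inner set"
  assumes "finite B"
  shows "\<exists>K. compact K \<and> (\<forall>c. (\<forall>b\<in>B. \<bar>c b\<bar> \<le> R) \<longrightarrow> (\<Sum>b\<in>B. c b *\<^sub>R b) \<in> K)"
  using assms
proof (induction B rule: finite_induct)
  case empty
  show ?case by (rule exI[of _ "{0}"]) simp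
next
  case (insert a B)
  from insert.IH obtain K where K: "compact K \<and> (\<forall>c. (\<forall>b\<in>B. \<bar>c b\<bar> \<le> R) \<longrightarrow> (\<Sum>b\<in>B. c b *\<^sub>R b) \<in> K)" ..
  let ?I = "(\<lambda>t. t *\<^sub>R a) ` {-R..R}"
  have "compact ?I"
    by (intro compact_continuous_image continuous_intros compact_Icc)
  then have cpt: "compact {x + y |x y. x \<in> ?I \<and> y \<in> K}"
    using K by (intro compact_sums) simp_all
  have "(\<Sum>b\<in>insert a B. c b *\<^sub>R b) \<in> {x + y |x y. x \<in> ?I \<and> y \<in> K}"
    if c: "\<forall>b\<in>insert a B. \<bar>c b\<bar> \<le> R" for c
  proof -
    have "c a *\<^sub>R a \<in> ?I" using c by (intro imageI) (simp add: abs_le_iff)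
    moreover have "(\<Sum>b\<in>B. c b *\<^sub>R b) \<in> K" using c K by simp
    ultimately show ?thesis unfolding sum.insert[OF insert(1,2)] by blast
  qed
  with cpt show ?case by (intro exI[of _ "{x + y |x y. x \<in> ?I \<and> y \<in> K}"]) simp
qed

text \<open>Coordinates are bounded by the norm, so a ball lies in a finite Minkowski sum of
  segments. This supplies the compactness for the maximum principle.\<close>

lemma orthonormal_basis_cball_in_compact:
  fixes B :: "'a::real_inner set"
  assumes "orthonormal_basis B"
  obtains K where "compact K" "\<And>x::'a. norm x \<le> R \<Longrightarrow> x \<in> K"
proof -
  from assms obtain K where K: "compact K" "\<And>c. (\<forall>b\<in>B. \<bar>c b\<bar> \<le> R) \<Longrightarrow> (\<Sum>b\<in>B. c b *\<^sub>R b) \<in> K"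
    using bounded_combinations_in_compact[of B R] unfolding orthonormal_basis_def by metis
  have inK: "x \<in> K" if "norm x \<le> R" for x
  proof -
    have "\<bar>inner x b\<bar> \<le> R" if "b \<in> B" for b
      using Cauchy_Schwarz_ineq2[of x b] orthonormal_basis_norm[OF assms that] \<open>norm x \<le> R\<close> by simp
    then have "(\<Sum>b\<in>B. inner x b *\<^sub>R b) \<in> K" by (intro K(2)) simp
    then show ?thesis unfolding orthonormal_basis_expansion[OF assms] .
  qed
  show ?thesis by (rule that[OF K(1) inK])
qed

text \<open>Either some finite orthonormal set cannot be extended, and then the residual of each
  expansion vanishes, or extending forever from the empty set yields a sequence.\<close>

lemma orthonormal_basis_or_sequence:
  "(\<exists>B::'a::real_inner set. orthonormal_basis B) \<or>
   (\<exists>e::nat \<Rightarrow> 'a. \<forall>i j. inner (e i) (e j) = (if i = j then 1 else 0))"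
proof -
  define on where "on B \<longleftrightarrow> finite B \<and> (\<forall>a\<in>B. \<forall>b\<in>B. inner a b = (if a = b then 1 else 0))" for B :: "'a set"
  show ?thesis
  proof (cases "\<exists>B. on B \<and> \<not> (\<exists>v. norm v = 1 \<and> (\<forall>b\<in>B. inner v b = 0))")
    case True
    then obtain B where B: "on B" "\<And>v. norm v = 1 \<Longrightarrow> \<exists>b\<in>B. inner v b \<noteq> 0" by metis
    note B' = B(1)[unfolded on_def]
    have "(\<Sum>b\<in>B. inner x b *\<^sub>R b) = x" for x
    proof (rule ccontr)
      assume ne: "(\<Sum>b\<in>B. inner x b *\<^sub>R b) \<noteq> x"
      define w where "w = x - (\<Sum>b\<in>B. inner x b *\<^sub>R b)"
      have orth: "inner w b = 0" if "b \<in> B" for b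
      proof -
        have "(\<Sum>c\<in>B. inner x c * inner c b) = (\<Sum>c\<in>B. if c = b then inner x b else 0)"
          by (rule sum.cong) (use B' that in auto)
        then show ?thesis using B' that by (simp add: w_def inner_diff_left inner_sum_left)
      qed
      have "norm (w /\<^sub>R norm w) = 1" using ne by (simp add: w_def)
      from B(2)[OF this] orth show False by auto
    qed
    with B' show ?thesis unfolding orthonormal_basis_def by blast
  next
    case False
    then have "\<forall>B. \<exists>v. on B \<longrightarrow> inner v v = 1 \<and> (\<forall>b\<in>B. inner v b = 0 \<and> inner b v = 0)"
      by (simp add: norm_eq_1 inner_commute)
    then obtain f where f: "\<And>B. on B \<Longrightarrow> inner (f B) (f B) = 1"
      "\<And>B b. on B \<Longrightarrow> b \<in> B \<Longrightarrow> inner (f B) b = 0" "\<And>B b. on B \<Longrightarrow> b \<in> B \<Longrightarrow> inner b (f B) = 0"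
      by metis
    define S where "S = rec_nat {} (\<lambda>_ B. insert (f B) B)"
    have S: "S 0 = {}" "S (Suc n) = insert (f (S n)) (S n)" for n by (simp_all add: S_def)
    have on: "on (S n)" for n
    proof (induction n)
      case (Suc n)
      note f' = f[OF Suc]
      from Suc have "finite (S n)" "\<And>a b. a \<in> S n \<Longrightarrow> b \<in> S n \<Longrightarrow> inner a b = (if a = b then 1 else 0)"
        by (simp_all add: on_def)
      moreover have "f (S n) \<noteq> b" "b \<noteq> f (S n)" if "b \<in> S n" for b
        using f'(1) f'(2)[OF that] by auto
      ultimately show ?case unfolding S on_def using f' by simp
    qed (simp add: S on_def)
    define e where "e n = f (S n)" for n
    have eS: "e i \<in> S n" if "i < n" for i n
      using that by (induction n) (auto simp: S(2) e_def less_Suc_eq)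
    have lt: "inner (e j) (e i) = 0" if "i < j" for i j
      using f(2)[OF on[of j]] eS[OF that] by (simp add: e_def)
    have "inner (e i) (e j) = (if i = j then 1 else 0)" for i j
      using lt[of i j] lt[of j i] f(1)[OF on[of i]]
      by (cases i j rule: linorder_cases) (simp_all add: inner_commute e_def)
    then show ?thesis by blast
  qed
qed

text \<open>By Bessel's inequality the squared coefficients are summable.\<close>

lemma orthonormal_sequence_weakly_null:
  fixes e :: "nat \<Rightarrow> 'a::real_inner"
  assumes e: "\<And>i j. inner (e i) (e j) = (if i = j then 1 else 0)"
  shows "(\<lambda>n. inner w (e n)) \<longlonglongrightarrow> 0"
proof -
  have bessel: "(\<Sum>i<n. (inner w (e i))\<^sup>2) \<le> (norm w)\<^sup>2" for n
  proof -
    define s where "s = (\<Sum>i<n. inner w (e i) *\<^sub>R e i)"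
    have ws: "inner w s = (\<Sum>i<n. (inner w (e i))\<^sup>2)"
      by (simp add: s_def inner_sum_right power2_eq_square)
    have "inner s (e j) = inner w (e j)" if "j < n" for j
    proof -
      have "(\<Sum>i<n. inner w (e i) * inner (e i) (e j)) = (\<Sum>i<n. if i = j then inner w (e j) else 0)"
        by (rule sum.cong) (auto simp: e)
      then show ?thesis using that by (simp add: s_def inner_sum_left)
    qed
    then have ss: "inner s s = (\<Sum>i<n. (inner w (e i))\<^sup>2)"
      by (subst (2) s_def) (simp add: inner_sum_right power2_eq_square)
    have "0 \<le> inner (w - s) (w - s)" by simp
    then show ?thesis using ws ss
      by (simp add: inner_diff_left inner_diff_right inner_commute power2_norm_eq_inner)
  qed
  have "summable (\<lambda>i. (inner w (e i))\<^sup>2)"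
    using bessel by (intro summableI_nonneg_bounded) auto
  then have "(\<lambda>i. sqrt ((inner w (e i))\<^sup>2)) \<longlonglongrightarrow> sqrt 0"
    by (intro tendsto_real_sqrt summable_LIMSEQ_zero)
  then show ?thesis by (simp add: tendsto_rabs_zero_iff)
qed

section \<open>A maximum principle\<close>

lemma norm_Pair_sq: "(norm (x, r))\<^sup>2 = (norm x)\<^sup>2 + (r::real)\<^sup>2" for x :: "'a::real_inner"
  by (simp add: norm_Pair)

text \<open>On a Euclidean space of dimension \<open>card B\<close>, the operator below discretises
  \<open>\<Delta>\<^sub>x + \<partial>\<^sub>r\<^sup>2 - (card B / r) \<partial>\<^sub>r\<close>, for which \<open>norm (x - z, r)\<close> is a solution: on radial functions
  it acts like the Laplacian in dimension one.\<close>

definition disc_op :: "'a::real_inner set \<Rightarrow> ('a \<times> real \<Rightarrow> real) \<Rightarrow> 'a \<times> real \<Rightarrow> real \<Rightarrow> real" where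
  "disc_op B G p t =
     ((\<Sum>b\<in>B. G (p + t *\<^sub>R (b, 0)) + G (p - t *\<^sub>R (b, 0)) - 2 * G p)
       + (G (p + t *\<^sub>R (0, 1)) + G (p - t *\<^sub>R (0, 1)) - 2 * G p)) / t\<^sup>2
     - real (card B) / snd p * ((G (p + t *\<^sub>R (0, 1)) - G (p - t *\<^sub>R (0, 1))) / (2 * t))"

lemma disc_op_add: "disc_op B (\<lambda>p. F p + G p) p t = disc_op B F p t + disc_op B G p t"
proof -
  let ?s = "\<lambda>G b. G (p + t *\<^sub>R (b, 0)) + G (p - t *\<^sub>R (b, 0)) - 2 * G p"
  have sums: "(\<Sum>b\<in>B. ?s (\<lambda>p. F p + G p) b) = (\<Sum>b\<in>B. ?s F b) + (\<Sum>b\<in>B. ?s G b)"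
    unfolding sum.distrib[symmetric] by (rule sum.cong) auto
  have arith: "((a + a') + (u + u' + (v + v') - 2 * (g + g'))) / s - c * ((u + u' - (v + v')) / d)
      = ((a + (u + v - 2 * g)) / s - c * ((u - v) / d)) + ((a' + (u' + v' - 2 * g')) / s - c * ((u' - v') / d))"
    for a a' u u' v v' g g' s c d :: real
    by (simp add: divide_inverse algebra_simps)
  show ?thesis unfolding disc_op_def sums by (rule arith)
qed

lemma disc_op_cmult: "disc_op B (\<lambda>p. c * F p) p t = c * disc_op B F p t"
proof -
  let ?s = "\<lambda>G b. G (p + t *\<^sub>R (b, 0)) + G (p - t *\<^sub>R (b, 0)) - 2 * G p"
  have sums: "(\<Sum>b\<in>B. ?s (\<lambda>p. c * F p) b) = c * (\<Sum>b\<in>B. ?s F b)"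
    unfolding sum_distrib_left by (rule sum.cong) (auto simp: algebra_simps)
  have arith: "(c * a + (c * u + c * v - 2 * (c * g))) / s - k * ((c * u - c * v) / d)
      = c * ((a + (u + v - 2 * g)) / s - k * ((u - v) / d))" for a u v g s k d :: real
    by (simp add: divide_inverse algebra_simps)
  show ?thesis unfolding disc_op_def sums by (rule arith)
qed

lemma disc_op_const: "disc_op B (\<lambda>p. c) p t = 0"
  by (simp add: disc_op_def)

lemma norm_sq_add_scaled:
  fixes w e :: "'a::real_inner" assumes "norm e = 1"
  shows "(norm (w + t *\<^sub>R e))\<^sup>2 = (norm w)\<^sup>2 + 2 * t * inner w e + t\<^sup>2"
  using assms unfolding power2_norm_eq_inner norm_eq_1
  by (simp add: inner_add_left inner_add_right inner_commute power2_eq_square)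

lemma norm_sq_diff_scaled:
  fixes w e :: "'a::real_inner" assumes "norm e = 1"
  shows "(norm (w - t *\<^sub>R e))\<^sup>2 = (norm w)\<^sup>2 - 2 * t * inner w e + t\<^sup>2"
  using norm_sq_add_scaled[OF assms, of w "- t"] by simp

text \<open>The \<open>card B + 1\<close> second differences give 2 each and the drift term removes
  \<open>2 * card B\<close>. The squared norm is thus a strict subsolution, the perturbation used in
  \<open>max_principle\<close>.\<close>

lemma disc_op_norm_sq:
  assumes B: "orthonormal_basis B" and "snd p > 0" "t > 0"
  shows "disc_op B (\<lambda>p. (norm p)\<^sup>2) p t = 2"
proof -
  have n: "norm (b, 0::real) = 1" if "b \<in> B" for b
    using orthonormal_basis_norm[OF B that] by (simp add: norm_Pair)
  have n1: "norm (0::'a, 1::real) = 1" by (simp add: norm_Pair)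
  have i: "inner p (0, 1) = snd p" by (cases p) simp
  have "(\<Sum>b\<in>B. (norm (p + t *\<^sub>R (b, 0)))\<^sup>2 + (norm (p - t *\<^sub>R (b, 0)))\<^sup>2 - 2 * (norm p)\<^sup>2) = (\<Sum>b\<in>B. 2 * t\<^sup>2)"
    by (rule sum.cong) (use norm_sq_add_scaled[OF n] norm_sq_diff_scaled[OF n] in auto)
  then have S: "(\<Sum>b\<in>B. (norm (p + t *\<^sub>R (b, 0)))\<^sup>2 + (norm (p - t *\<^sub>R (b, 0)))\<^sup>2 - 2 * (norm p)\<^sup>2) = real (card B) * (2 * t\<^sup>2)"
    by (simp only: sum_constant)
  have A: "(norm (p + t *\<^sub>R (0, 1)))\<^sup>2 + (norm (p - t *\<^sub>R (0, 1)))\<^sup>2 - 2 * (norm p)\<^sup>2 = 2 * t\<^sup>2"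
    and D: "(norm (p + t *\<^sub>R (0, 1)))\<^sup>2 - (norm (p - t *\<^sub>R (0, 1)))\<^sup>2 = 4 * t * snd p"
    using norm_sq_add_scaled[OF n1, of p t] norm_sq_diff_scaled[OF n1, of p t] i by simp_all
  show ?thesis
    unfolding disc_op_def S A D using assms(2,3) by (simp add: field_simps)
qed

text \<open>The limit is the second directional derivative of the norm; expanding the squares
  reduces it to scalar square roots.\<close>

lemma norm_second_difference_tendsto:
  fixes w e :: "'a::real_inner" assumes "norm e = 1" "w \<noteq> 0"
  shows "((\<lambda>t. (norm (w + t *\<^sub>R e) + norm (w - t *\<^sub>R e) - 2 * norm w) / t\<^sup>2)
     \<longlongrightarrow> 1 / norm w - (inner w e)\<^sup>2 / norm w ^ 3) (at_right 0)"
proof -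
  define \<rho> b where "\<rho> = norm w" and "b = inner w e"
  have \<rho>: "\<rho> > 0" using assms by (simp add: \<rho>_def)
  have "norm (w + t *\<^sub>R e) = sqrt (\<rho>\<^sup>2 + 2 * t * b + t\<^sup>2)" "norm (w - t *\<^sub>R e) = sqrt (\<rho>\<^sup>2 - 2 * t * b + t\<^sup>2)" for t
    using norm_sq_add_scaled[OF assms(1), of w t] norm_sq_diff_scaled[OF assms(1), of w t]
    by (auto simp: \<rho>_def b_def intro!: real_sqrt_unique[symmetric])
  moreover have "((\<lambda>t. (sqrt (\<rho>\<^sup>2 + 2 * t * b + t\<^sup>2) + sqrt (\<rho>\<^sup>2 - 2 * t * b + t\<^sup>2) - 2 * \<rho>) / t\<^sup>2)
     \<longlongrightarrow> 1 / \<rho> - b\<^sup>2 / \<rho> ^ 3) (at_right 0)"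
    using \<rho> by real_asymp (simp add: field_simps power2_eq_square power3_eq_cube)
  ultimately show ?thesis by (simp add: \<rho>_def b_def)
qed

lemma norm_first_difference_tendsto:
  fixes w e :: "'a::real_inner" assumes "norm e = 1" "w \<noteq> 0"
  shows "((\<lambda>t. (norm (w + t *\<^sub>R e) - norm (w - t *\<^sub>R e)) / (2 * t)) \<longlongrightarrow> inner w e / norm w) (at_right 0)"
proof -
  define \<rho> b where "\<rho> = norm w" and "b = inner w e"
  have \<rho>: "\<rho> > 0" using assms by (simp add: \<rho>_def)
  have "norm (w + t *\<^sub>R e) = sqrt (\<rho>\<^sup>2 + 2 * t * b + t\<^sup>2)" "norm (w - t *\<^sub>R e) = sqrt (\<rho>\<^sup>2 - 2 * t * b + t\<^sup>2)" for t
    using norm_sq_add_scaled[OF assms(1), of w t] norm_sq_diff_scaled[OF assms(1), of w t]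
    by (auto simp: \<rho>_def b_def intro!: real_sqrt_unique[symmetric])
  moreover have "((\<lambda>t. (sqrt (\<rho>\<^sup>2 + 2 * t * b + t\<^sup>2) - sqrt (\<rho>\<^sup>2 - 2 * t * b + t\<^sup>2)) / (2 * t))
     \<longlongrightarrow> b / \<rho>) (at_right 0)"
    using \<rho> by real_asymp (simp add: field_simps power2_eq_square power3_eq_cube)
  ultimately show ?thesis by (simp add: \<rho>_def b_def)
qed

text \<open>Convexity gives the lower bound, the parallelogram law the upper one. They hold for all
  \<open>t > 0\<close>, as domination requires.\<close>

lemma norm_second_difference_bounds:
  fixes w e :: "'a::real_inner" assumes "norm e = 1" "w \<noteq> 0" "t > 0"
  shows "0 \<le> norm (w + t *\<^sub>R e) + norm (w - t *\<^sub>R e) - 2 * norm w"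
    and "norm (w + t *\<^sub>R e) + norm (w - t *\<^sub>R e) - 2 * norm w \<le> t\<^sup>2 / norm w"
proof -
  let ?a = "norm (w + t *\<^sub>R e)" and ?b = "norm (w - t *\<^sub>R e)" and ?\<rho> = "norm w"
  have "norm ((w + t *\<^sub>R e) + (w - t *\<^sub>R e)) \<le> ?a + ?b" by (rule norm_triangle_ineq)
  moreover have "(w + t *\<^sub>R e) + (w - t *\<^sub>R e) = 2 *\<^sub>R w" by (simp add: scaleR_2)
  ultimately show "0 \<le> ?a + ?b - 2 * ?\<rho>" by simp
  have "(?a + ?b)\<^sup>2 \<le> 2 * (?a\<^sup>2 + ?b\<^sup>2)"
    using zero_le_power2[of "?a - ?b"] by (simp add: power2_eq_square algebra_simps)
  also have "\<dots> = 4 * ?\<rho>\<^sup>2 + 4 * t\<^sup>2"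
    using norm_sq_add_scaled[OF assms(1), of w t] norm_sq_diff_scaled[OF assms(1), of w t] by simp
  also have "\<dots> \<le> (2 * ?\<rho> + t\<^sup>2 / ?\<rho>)\<^sup>2"
    using assms by (simp add: power2_sum power_mult_distrib power_divide)
  finally have "?a + ?b \<le> 2 * ?\<rho> + t\<^sup>2 / ?\<rho>" by (rule power2_le_imp_le) simp
  then show "?a + ?b - 2 * ?\<rho> \<le> t\<^sup>2 / ?\<rho>" by simp
qed

text \<open>By Parseval, the second derivatives of the norm at \<open>w\<close> sum to
  \<open>card B / norm w\<close>. Since \<open>z\<close> enters at height 0, \<open>w\<close> has
  height \<open>snd p\<close>, and the drift term cancels this exactly.\<close>

lemma disc_op_norm_tendsto:
  fixes z :: "'a::real_inner"
  assumes B: "orthonormal_basis B" and p: "snd p > 0"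
  shows "((\<lambda>t. disc_op B (\<lambda>p. norm (p - (z, 0))) p t) \<longlongrightarrow> 0) (at_right 0)"
proof -
  define w where "w = p - (z, 0)"
  have sw: "snd w = snd p" by (simp add: w_def)
  then have w0: "w \<noteq> 0" using p by auto
  have n: "norm (b, 0::real) = 1" if "b \<in> B" for b
    using orthonormal_basis_norm[OF B that] by (simp add: norm_Pair)
  have n1: "norm (0::'a, 1::real) = 1" by (simp add: norm_Pair)
  have s: "p + v - (z, 0) = w + v" "p - v - (z, 0) = w - v" for v by (simp_all add: w_def)
  have "((\<lambda>t. (\<Sum>b\<in>B. (norm (w + t *\<^sub>R (b, 0)) + norm (w - t *\<^sub>R (b, 0)) - 2 * norm w) / t\<^sup>2)
      + (norm (w + t *\<^sub>R (0, 1)) + norm (w - t *\<^sub>R (0, 1)) - 2 * norm w) / t\<^sup>2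
      - real (card B) / snd p * ((norm (w + t *\<^sub>R (0, 1)) - norm (w - t *\<^sub>R (0, 1))) / (2 * t)))
     \<longlongrightarrow> (\<Sum>b\<in>B. 1 / norm w - (inner w (b, 0))\<^sup>2 / norm w ^ 3)
      + (1 / norm w - (inner w (0, 1))\<^sup>2 / norm w ^ 3)
      - real (card B) / snd p * (inner w (0, 1) / norm w)) (at_right 0)" (is "(_ \<longlongrightarrow> ?l) _")
    by (intro tendsto_intros norm_second_difference_tendsto norm_first_difference_tendsto n n1 w0)
  moreover have "?l = 0"
  proof -
    have fw: "inner w (b, 0) = inner (fst w) b" "inner w (0, 1) = snd p" for b
      using sw by (cases w; simp)+
    have "(norm w)\<^sup>2 = (norm (fst w))\<^sup>2 + (snd p)\<^sup>2"
      using sw by (cases w) (simp add: norm_Pair_sq)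
    then have q: "(snd p)\<^sup>2 = (norm w)\<^sup>2 - (norm (fst w))\<^sup>2" by simp
    have "?l = real (card B) / norm w - (norm (fst w))\<^sup>2 / norm w ^ 3
       + (1 / norm w - (snd p)\<^sup>2 / norm w ^ 3) - real (card B) / norm w"
      using p unfolding fw by (simp add: sum_subtractf sum_divide_distrib[symmetric] orthonormal_basis_parseval[OF B])
    also have "\<dots> = 0"
      using w0 unfolding q by (simp add: field_simps power2_eq_square power3_eq_cube)
    finally show ?thesis .
  qed
  ultimately show ?thesis
    unfolding disc_op_def s by (simp add: w_def[symmetric] add_divide_distrib sum_divide_distrib)
qed

text \<open>The bound is uniform in \<open>z\<close> and \<open>t\<close>: \<open>card B + 1\<close>
  second differences of at most \<open>1 / snd p\<close> each, and a drift quotient of at most 1 by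
  the triangle inequality.\<close>

lemma disc_op_norm_bound:
  fixes z :: "'a::real_inner"
  assumes B: "orthonormal_basis B" and p: "snd p > 0" and t: "t > 0"
  shows "\<bar>disc_op B (\<lambda>p. norm (p - (z, 0))) p t\<bar> \<le> (2 * real (card B) + 1) / snd p"
proof -
  define w where "w = p - (z, 0)"
  have sw: "snd w = snd p" by (simp add: w_def)
  then have w0: "w \<noteq> 0" using p by auto
  have pw: "snd p \<le> norm w"
    using norm_snd_le[of "snd w" "fst w"] sw p by (cases w) simp
  have n: "norm (b, 0::real) = 1" if "b \<in> B" for b
    using orthonormal_basis_norm[OF B that] by (simp add: norm_Pair)
  have n1: "norm (0::'a, 1::real) = 1" by (simp add: norm_Pair)
  have s: "p + v - (z, 0) = w + v" "p - v - (z, 0) = w - v" for v by (simp_all add: w_def)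
  have b2: "\<bar>(norm (w + t *\<^sub>R e) + norm (w - t *\<^sub>R e) - 2 * norm w) / t\<^sup>2\<bar> \<le> 1 / snd p" if "norm e = 1" for e
  proof -
    have "\<bar>(norm (w + t *\<^sub>R e) + norm (w - t *\<^sub>R e) - 2 * norm w) / t\<^sup>2\<bar> \<le> 1 / norm w"
      using norm_second_difference_bounds[OF that w0 t] t by (simp add: field_simps)
    also have "\<dots> \<le> 1 / snd p" using pw p w0 by (intro divide_left_mono mult_pos_pos) auto
    finally show ?thesis .
  qed
  have b1: "\<bar>(norm (w + t *\<^sub>R (0, 1)) - norm (w - t *\<^sub>R (0, 1))) / (2 * t)\<bar> \<le> 1"
  proof -
    have "\<bar>norm (w + t *\<^sub>R (0, 1)) - norm (w - t *\<^sub>R (0, 1))\<bar> \<le> norm ((w + t *\<^sub>R (0, 1)) - (w - t *\<^sub>R (0, 1)))"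
      by (rule norm_triangle_ineq3)
    also have "(w + t *\<^sub>R (0, 1)) - (w - t *\<^sub>R (0, 1)) = (2 * t) *\<^sub>R (0, 1)"
      by (simp add: algebra_simps flip: scaleR_2)
    also have "norm ((2 * t) *\<^sub>R (0::'a, 1::real)) = 2 * t" using n1 t unfolding norm_scaleR by simp
    finally show ?thesis using t by (simp add: divide_simps)
  qed
  have "\<bar>\<Sum>b\<in>B. (norm (w + t *\<^sub>R (b, 0)) + norm (w - t *\<^sub>R (b, 0)) - 2 * norm w) / t\<^sup>2\<bar> \<le> (\<Sum>b\<in>B. 1 / snd p)"
    by (rule order.trans[OF sum_abs sum_mono]) (rule b2[OF n])
  moreover have "\<bar>real (card B) / snd p * ((norm (w + t *\<^sub>R (0, 1)) - norm (w - t *\<^sub>R (0, 1))) / (2 * t))\<bar> \<le> real (card B) / snd p * 1"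
    unfolding abs_mult using b1 p by (intro mult_mono) auto
  moreover note b2[OF n1]
  ultimately have "\<bar>(\<Sum>b\<in>B. (norm (w + t *\<^sub>R (b, 0)) + norm (w - t *\<^sub>R (b, 0)) - 2 * norm w) / t\<^sup>2)
      + (norm (w + t *\<^sub>R (0, 1)) + norm (w - t *\<^sub>R (0, 1)) - 2 * norm w) / t\<^sup>2
      - real (card B) / snd p * ((norm (w + t *\<^sub>R (0, 1)) - norm (w - t *\<^sub>R (0, 1))) / (2 * t))\<bar>
     \<le> (\<Sum>b\<in>B. 1 / snd p) + 1 / snd p + real (card B) / snd p * 1"
    by linarith
  also have "\<dots> = (2 * real (card B) + 1) / snd p" by (simp add: add_divide_distrib)
  finally show ?thesis
    unfolding disc_op_def s by (simp add: w_def[symmetric] add_divide_distrib sum_divide_distrib)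
qed

text \<open>The bound on \<open>t\<close> makes the weight \<open>1 / t^2 - k\<close> of the upper
  neighbour nonnegative; then every neighbour enters with nonnegative weight.\<close>

lemma disc_op_nonpos_at_max:
  assumes "t > 0" "snd p > 0" "real (card B) * t \<le> 2 * snd p"
    and max: "\<And>b. b \<in> B \<Longrightarrow> G (p + t *\<^sub>R (b, 0)) \<le> G p" "\<And>b. b \<in> B \<Longrightarrow> G (p - t *\<^sub>R (b, 0)) \<le> G p"
      "G (p + t *\<^sub>R (0, 1)) \<le> G p" "G (p - t *\<^sub>R (0, 1)) \<le> G p"
  shows "disc_op B G p t \<le> 0"
proof -
  define u v where "u = G (p + t *\<^sub>R (0, 1)) - G p" and "v = G (p - t *\<^sub>R (0, 1)) - G p"
  define k where "k = real (card B) / (2 * snd p * t)"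
  have k: "0 \<le> k" "k \<le> 1 / t\<^sup>2"
    using assms by (auto simp: k_def field_simps power2_eq_square)
  have "(\<Sum>b\<in>B. G (p + t *\<^sub>R (b, 0)) + G (p - t *\<^sub>R (b, 0)) - 2 * G p) \<le> 0"
    by (rule sum_nonpos) (use max(1,2) in force)
  then have "(\<Sum>b\<in>B. G (p + t *\<^sub>R (b, 0)) + G (p - t *\<^sub>R (b, 0)) - 2 * G p) / t\<^sup>2 \<le> 0"
    by (simp add: divide_nonpos_nonneg)
  moreover have "(1 / t\<^sup>2 - k) * u \<le> 0" "(1 / t\<^sup>2 + k) * v \<le> 0"
    using k max(3,4) by (auto intro!: mult_nonneg_nonpos simp: u_def v_def)
  moreover have "disc_op B G p t = (\<Sum>b\<in>B. G (p + t *\<^sub>R (b, 0)) + G (p - t *\<^sub>R (b, 0)) - 2 * G p) / t\<^sup>2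
      + ((1 / t\<^sup>2 - k) * u + (1 / t\<^sup>2 + k) * v)"
  proof -
    have G: "G (p + t *\<^sub>R (0, 1)) = G p + u" "G (p - t *\<^sub>R (0, 1)) = G p + v"
      by (simp_all add: u_def v_def)
    have "real (card B) / snd p * ((u - v) / (2 * t)) = k * (u - v)"
      by (simp add: k_def)
    then show ?thesis
      unfolding disc_op_def G by (simp add: add_divide_distrib algebra_simps)
  qed
  ultimately show ?thesis by linarith
qed

text \<open>Subtracting \<open>\<epsilon> * norm p\<close>, a solution that beats the growth of
  \<open>u\<close>, keeps the maximum away from infinity. Adding \<open>\<eta> * (norm p)^2\<close>
  makes the operator tend to \<open>2 * \<eta> > 0\<close>, which is impossible at an interior
  maximum.\<close>

lemma max_principle:
  fixes u :: "'a::real_inner \<times> real \<Rightarrow> real"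
  assumes B: "orthonormal_basis B"
    and cont: "continuous_on UNIV u"
    and bdry: "\<And>x. u (x, 0) \<le> 0"
    and growth: "\<And>\<epsilon>. \<epsilon> > 0 \<Longrightarrow> \<exists>R. \<forall>p. norm p \<ge> R \<longrightarrow> u p \<le> \<epsilon> * norm p"
    and harm: "\<And>p. snd p > 0 \<Longrightarrow> (\<lambda>n. disc_op B u p (inverse (real (Suc n)))) \<longlonglongrightarrow> 0"
    and "r \<ge> 0"
  shows "u (x, r) \<le> 0"
proof (rule ccontr)
  define p0 where "p0 = (x, r)"
  assume "\<not> u (x, r) \<le> 0"
  then have up0: "u p0 > 0" by (simp add: p0_def)
  \<comment> \<open>Chosen so that \<open>u - \<epsilon> * norm\<close> keeps at least half of its
    positive value at \<open>p0\<close>.\<close>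
  define \<epsilon> where "\<epsilon> = u p0 / (2 * (norm p0 + 1))"
  have \<epsilon>: "\<epsilon> > 0" using up0 by (auto simp: \<epsilon>_def intro!: divide_pos_pos add_nonneg_pos)
  have "\<epsilon> * norm p0 \<le> \<epsilon> * (norm p0 + 1)" using \<epsilon> by (simp add: algebra_simps)
  also have "\<dots> = u p0 / 2"
    using add_nonneg_pos[of "norm p0" 1] by (simp add: \<epsilon>_def field_simps)
  finally have g0: "u p0 - \<epsilon> * norm p0 > 0" using up0 by simp
  obtain R where R: "\<And>p. norm p \<ge> R \<Longrightarrow> u p \<le> \<epsilon> * norm p" using growth[OF \<epsilon>] by blast
  then have p0R: "norm p0 < R" using g0 by (meson diff_gt_0_iff_gt leD not_le_imp_less)
  obtain K where K: "compact K" "\<And>x::'a. norm x \<le> R \<Longrightarrow> x \<in> K"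
    using orthonormal_basis_cball_in_compact[OF B, of R] by blast
  define C where "C = K \<times> {0..R}"
  have C: "compact C" unfolding C_def by (intro compact_Times K compact_Icc)
  have inC: "p \<in> C" if "norm p \<le> R" "snd p \<ge> 0" for p
    using that norm_fst_le[of "fst p" "snd p"] norm_snd_le[of "snd p" "fst p"] K(2)
    by (cases p) (auto simp: C_def)
  obtain S where S: "S > 0" "\<And>p. p \<in> C \<Longrightarrow> norm p \<le> S"
    using compact_imp_bounded[OF C] by (auto simp: bounded_pos)
  \<comment> \<open>Chosen so that on \<open>C\<close> the quadratic term uses up at most half of
    the remaining margin at \<open>p0\<close>.\<close>
  define \<eta> where "\<eta> = (u p0 - \<epsilon> * norm p0) / (2 * S\<^sup>2)"
  have \<eta>: "\<eta> > 0" using g0 S by (simp add: \<eta>_def)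
  have \<eta>S: "\<eta> * (norm p)\<^sup>2 < u p0 - \<epsilon> * norm p0" if "p \<in> C" for p
  proof -
    have "\<eta> * (norm p)\<^sup>2 \<le> \<eta> * S\<^sup>2" using \<eta> S(2)[OF that] by (simp add: power_mono)
    also have "\<dots> = (u p0 - \<epsilon> * norm p0) / 2" using S by (simp add: \<eta>_def)
    finally show ?thesis using g0 by simp
  qed
  define G where "G p = u p + ((- \<epsilon>) * norm p + \<eta> * (norm p)\<^sup>2)" for p
  have "continuous_on C G"
    unfolding G_def by (intro continuous_intros continuous_on_subset[OF cont]) auto
  moreover have p0C: "p0 \<in> C" using p0R assms(6) by (intro inC) (auto simp: p0_def)
  ultimately obtain p1 where p1: "p1 \<in> C" "\<And>p. p \<in> C \<Longrightarrow> G p \<le> G p1"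
    using continuous_attains_sup[OF C] by blast
  have "u p0 - \<epsilon> * norm p0 \<le> G p0" using \<eta> by (simp add: G_def)
  then have G1: "u p0 - \<epsilon> * norm p0 \<le> G p1" using p1(2)[OF p0C] by simp
  have "snd p1 \<noteq> 0"
  proof
    assume "snd p1 = 0"
    then have "u p1 \<le> 0" using bdry[of "fst p1"] by (cases p1) simp
    moreover have "\<epsilon> * norm p1 \<ge> 0" using \<epsilon> by simp
    ultimately show False using G1 \<eta>S[OF p1(1)] by (simp add: G_def)
  qed
  moreover have "snd p1 \<ge> 0" using p1(1) by (auto simp: C_def)
  ultimately have s1: "snd p1 > 0" by simp
  \<comment> \<open>\<open>C\<close> contains the half ball of radius \<open>R\<close> but may be
    larger. The growth bound covers the surplus, so the maximum still has norm below
    \<open>R\<close>.\<close>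
  have p1R: "norm p1 < R"
  proof (rule ccontr)
    assume "\<not> norm p1 < R"
    then have "u p1 \<le> \<epsilon> * norm p1" by (intro R) simp
    then show False using G1 \<eta>S[OF p1(1)] by (simp add: G_def)
  qed
  have near: "G (p1 + v) \<le> G p1" if "norm v \<le> R - norm p1" "norm v \<le> snd p1" for v
  proof (intro p1(2) inC)
    show "norm (p1 + v) \<le> R" using norm_triangle_ineq[of p1 v] that(1) by simp
    show "snd (p1 + v) \<ge> 0" using norm_snd_le[of "snd v" "fst v"] that(2) by (cases v) auto
  qed
  have near': "G (p1 - v) \<le> G p1" if "norm v \<le> R - norm p1" "norm v \<le> snd p1" for v
    using near[of "- v"] that by simp
  \<comment> \<open>Steps up to \<open>d\<close> stay in the ball and in the half space, and meet
    the step condition of \<open>disc_op_nonpos_at_max\<close>.\<close>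
  define d where "d = Min {R - norm p1, snd p1, 2 * snd p1 / (real (card B) + 1)}"
  have d: "d > 0" "d \<le> R - norm p1" "d \<le> snd p1" "d \<le> 2 * snd p1 / (real (card B) + 1)"
    using p1R s1 by (auto simp: d_def)
  have neg: "disc_op B G p1 t \<le> 0" if t: "0 < t" "t \<le> d" for t
  proof (rule disc_op_nonpos_at_max[OF t(1) s1])
    have "t * (real (card B) + 1) \<le> 2 * snd p1"
      using t d(4) by (simp add: pos_le_divide_eq[symmetric])
    then show "real (card B) * t \<le> 2 * snd p1" using t by (simp add: algebra_simps)
    have n: "norm (t *\<^sub>R (b, 0::real)) = t" if "b \<in> B" for b
      using orthonormal_basis_norm[OF B that] t by (simp add: norm_Pair)
    have n1: "norm (t *\<^sub>R (0::'a, 1::real)) = t" using t by (simp add: norm_Pair)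
    show "G (p1 + t *\<^sub>R (b, 0)) \<le> G p1" "G (p1 - t *\<^sub>R (b, 0)) \<le> G p1" if "b \<in> B" for b
      using near[of "t *\<^sub>R (b, 0)"] near'[of "t *\<^sub>R (b, 0)"] n[OF that] t d by simp_all
    show "G (p1 + t *\<^sub>R (0, 1)) \<le> G p1" "G (p1 - t *\<^sub>R (0, 1)) \<le> G p1"
      using near[of "t *\<^sub>R (0, 1)"] near'[of "t *\<^sub>R (0, 1)"] n1 t d by simp_all
  qed
  have t0: "filterlim (\<lambda>n. inverse (real (Suc n))) (at_right 0) sequentially"
    by real_asymp
  have normlim: "(\<lambda>n. disc_op B norm p1 (inverse (real (Suc n)))) \<longlonglongrightarrow> 0"
    using filterlim_compose[OF disc_op_norm_tendsto[OF B s1, of 0] t0] by (simp flip: zero_prod_def)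
  have "(\<lambda>n. disc_op B u p1 (inverse (real (Suc n))) + ((- \<epsilon>) * disc_op B norm p1 (inverse (real (Suc n))) + \<eta> * 2))
     \<longlonglongrightarrow> 0 + ((- \<epsilon>) * 0 + \<eta> * 2)"
    by (intro tendsto_intros harm s1 normlim)
  also have "(\<lambda>n. disc_op B u p1 (inverse (real (Suc n))) + ((- \<epsilon>) * disc_op B norm p1 (inverse (real (Suc n))) + \<eta> * 2))
    = (\<lambda>n. disc_op B G p1 (inverse (real (Suc n))))"
    unfolding G_def disc_op_add disc_op_cmult by (simp add: disc_op_norm_sq[OF B s1])
  finally have lim: "(\<lambda>n. disc_op B G p1 (inverse (real (Suc n)))) \<longlonglongrightarrow> \<eta> * 2" by simp
  have "\<forall>\<^sub>F n in sequentially. inverse (real (Suc n)) < d"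
    using order_tendstoD(2)[OF LIMSEQ_inverse_real_of_nat d(1)] .
  then have "\<forall>\<^sub>F n in sequentially. disc_op B G p1 (inverse (real (Suc n))) \<le> 0"
    by eventually_elim (intro neg, auto)
  then have "\<eta> * 2 \<le> 0" by (intro tendsto_upperbound[OF lim]) auto
  with \<eta> show False by simp
qed

section \<open>Growth of potentials and their behaviour under the operator\<close>

lemma pot_growth:
  fixes M :: "'h::{real_inner, banach, second_countable_topology} measure"
  assumes M: "prob_space M" "sets M = sets borel" and "\<epsilon> > 0"
  shows "\<exists>R. \<forall>p. norm p \<ge> R \<longrightarrow> \<bar>pot M p - norm p\<bar> \<le> \<epsilon> * norm p"
proof -
  interpret prob_space M by fact
  note [measurable_cong] = M(2)
  \<comment> \<open>Truncating at 1 replaces a first moment: the truncated integral tends to 0 as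
    the scale grows, and it controls the deviation relative to \<open>norm p\<close>.\<close>
  have g: "integrable M (\<lambda>z. min (norm z * c) 1)" if "c \<ge> 0" for c
    using that by (intro integrable_const_bound[where B = 1]) auto
  have "(\<lambda>n. LINT z|M. min (norm z * inverse (real (Suc n))) 1) \<longlonglongrightarrow> (LINT z|M. 0)"
  proof (rule integral_dominated_convergence[where w = "\<lambda>_. 1"])
    have "(\<lambda>n. min (norm z * inverse (real (Suc n))) 1) \<longlonglongrightarrow> min (norm z * 0) 1" for z :: 'h
      by (intro tendsto_intros LIMSEQ_inverse_real_of_nat)
    then show "AE z in M. (\<lambda>n. min (norm z * inverse (real (Suc n))) 1) \<longlonglongrightarrow> 0" by simp
  qed auto
  then have "\<forall>\<^sub>F n in sequentially. (LINT z|M. min (norm z * inverse (real (Suc n))) 1) < \<epsilon> / 2"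
    using \<open>\<epsilon> > 0\<close> by (intro order_tendstoD) auto
  then obtain n where n: "(LINT z|M. min (norm z * inverse (real (Suc n))) 1) < \<epsilon> / 2"
    by (auto simp: eventually_sequentially)
  have "\<bar>pot M p - norm p\<bar> \<le> \<epsilon> * norm p" if p: "norm p \<ge> real (Suc n)" for p
  proof -
    let ?k = "\<lambda>z::'h. norm (p - (z, 0::real)) - norm z"
    have b: "\<bar>?k z - norm p\<bar> \<le> 2 * norm p * min (norm z * inverse (real (Suc n))) 1" for z
    proof -
      have "\<bar>norm (p - (z, 0)) - norm p\<bar> \<le> norm z"
        using norm_triangle_ineq3[of "p - (z, 0)" p] by (simp add: norm_Pair)
      then have "\<bar>?k z - norm p\<bar> \<le> 2 * norm z" by linarith
      moreover have "\<bar>?k z - norm p\<bar> \<le> 2 * norm p" using abs_kernel_le[of p z] by linarith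
      moreover have "2 * norm z \<le> 2 * norm p * (norm z * inverse (real (Suc n)))"
        using mult_left_mono[OF p norm_ge_zero[of z]] by (simp add: field_simps)
      ultimately show ?thesis by (auto simp: min_def)
    qed
    have k: "integrable M ?k" by (rule integrable_kernel[OF M])
    have "pot M p - norm p = (LINT z|M. ?k z - norm p)"
      using k by (simp add: pot_def prob_space)
    also have "\<bar>\<dots>\<bar> \<le> (LINT z|M. 2 * norm p * min (norm z * inverse (real (Suc n))) 1)"
      using k g[of "inverse (real (Suc n))"]
      by (intro order.trans[OF integral_abs_bound] integral_mono b) auto
    also have "\<dots> = 2 * norm p * (LINT z|M. min (norm z * inverse (real (Suc n))) 1)" by simp
    also have "\<dots> \<le> 2 * norm p * (\<epsilon> / 2)" using n by (intro mult_left_mono) auto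
    finally show ?thesis by (simp add: mult.commute)
  qed
  then show ?thesis by blast
qed

text \<open>A finite linear combination commutes with the integral, so no differentiation under the
  integral sign is needed.\<close>

lemma disc_op_pot:
  fixes M :: "'h::{real_inner, banach, second_countable_topology} measure"
  assumes M: "prob_space M" "sets M = sets borel"
  shows "integrable M (\<lambda>z. disc_op B (\<lambda>p. norm (p - (z, 0))) p t)"
    and "disc_op B (pot M) p t = (LINT z|M. disc_op B (\<lambda>p. norm (p - (z, 0))) p t)"
proof -
  note i = integrable_kernel[OF M]
  \<comment> \<open>The operator kills constants, so \<open>- norm z\<close> may be inserted to make
    each single term integrable.\<close>
  have eq: "disc_op B (\<lambda>p. norm (p - (z, 0))) p t = disc_op B (\<lambda>p. norm (p - (z, 0)) - norm z) p t" for z :: 'h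
    using disc_op_add[of B "\<lambda>p. norm (p - (z, 0))" "\<lambda>_. - norm z" p t] by (simp add: disc_op_const)
  show "integrable M (\<lambda>z. disc_op B (\<lambda>p. norm (p - (z, 0))) p t)"
    unfolding eq unfolding disc_op_def
    by (intro Bochner_Integration.integrable_diff Bochner_Integration.integrable_add integrable_mult_right
        integrable_divide Bochner_Integration.integrable_sum i)
  show "disc_op B (pot M) p t = (LINT z|M. disc_op B (\<lambda>p. norm (p - (z, 0))) p t)"
    unfolding eq unfolding disc_op_def pot_def
    by (simp only: Bochner_Integration.integral_diff Bochner_Integration.integral_add integral_mult_right_zero
        integral_divide_zero Bochner_Integration.integral_sum i
        Bochner_Integration.integrable_diff Bochner_Integration.integrable_add integrable_mult_right
        integrable_divide Bochner_Integration.integrable_sum simp_thms)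
qed

lemma disc_op_pot_tendsto:
  fixes M :: "'h::{real_inner, banach, second_countable_topology} measure"
  assumes M: "prob_space M" "sets M = sets borel" and B: "orthonormal_basis B" and p: "snd p > 0"
  shows "(\<lambda>n. disc_op B (pot M) p (inverse (real (Suc n)))) \<longlonglongrightarrow> 0"
proof -
  interpret prob_space M by fact
  have t0: "filterlim (\<lambda>n. inverse (real (Suc n))) (at_right 0) sequentially"
    by real_asymp
  let ?d = "\<lambda>n z. disc_op B (\<lambda>p. norm (p - (z, 0))) p (inverse (real (Suc n)))"
  have "(\<lambda>n. LINT z|M. ?d n z) \<longlonglongrightarrow> (LINT z|M. 0)"
  proof (rule integral_dominated_convergence[where w = "\<lambda>_. (2 * real (card B) + 1) / snd p"])
    show "?d n \<in> borel_measurable M" for n using disc_op_pot(1)[OF M] by (rule borel_measurable_integrable)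
    show "AE z in M. (\<lambda>n. ?d n z) \<longlonglongrightarrow> 0"
      by (intro AE_I2 filterlim_compose[OF disc_op_norm_tendsto[OF B p] t0])
    show "AE z in M. norm (?d n z) \<le> (2 * real (card B) + 1) / snd p" for n
      unfolding real_norm_def by (intro AE_I2 disc_op_norm_bound[OF B p]) simp
  qed simp_all
  then show ?thesis by (simp add: disc_op_pot(2)[OF M])
qed

section \<open>Vanishing of the potential difference on the half space\<close>

context borel_prob_pair
begin

text \<open>Moving \<open>x\<close> by \<open>r\<close> along a weakly null orthonormal sequence acts in the limit like an extra
  coordinate \<open>r\<close>.\<close>

lemma pdiff_eq_0_sequence:
  fixes e :: "nat \<Rightarrow> 'h"
  assumes e: "\<And>i j. inner (e i) (e j) = (if i = j then 1 else 0)"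
    and bdry: "\<And>x. pdiff (x, 0) = 0"
  shows "pdiff (x, r) = 0"
proof -
  have "agree (\<lambda>z. norm ((x, r) - (z, 0)) - norm z)"
  proof (rule agree_limit[where f = "\<lambda>n z. norm ((x + r *\<^sub>R e n, 0::real) - (z, 0)) - norm z" and C = "norm x + \<bar>r\<bar>"])
    have ne: "norm (e n) = 1" for n using e[of n n] by (simp add: norm_eq_1)
    show "agree (\<lambda>z. norm ((x + r *\<^sub>R e n, 0::real) - (z, 0)) - norm z)" for n
      unfolding agree_kernel_iff by (rule bdry)
    show "\<bar>norm ((x + r *\<^sub>R e n, 0::real) - (z, 0)) - norm z\<bar> \<le> norm x + \<bar>r\<bar>" for n z
      using abs_kernel_le[of "(x + r *\<^sub>R e n, 0)" z] norm_triangle_ineq[of x "r *\<^sub>R e n"] ne[of n]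
      by (simp add: norm_Pair)
    fix z
    have "(\<lambda>n. sqrt ((norm (x - z))\<^sup>2 + 2 * r * inner (x - z) (e n) + r\<^sup>2) - norm z)
        \<longlonglongrightarrow> sqrt ((norm (x - z))\<^sup>2 + 2 * r * 0 + r\<^sup>2) - norm z"
      by (intro tendsto_intros orthonormal_sequence_weakly_null e)
    moreover have "norm ((x + r *\<^sub>R e n, 0::real) - (z, 0)) = sqrt ((norm (x - z))\<^sup>2 + 2 * r * inner (x - z) (e n) + r\<^sup>2)" for n
    proof -
      have "norm ((x + r *\<^sub>R e n, 0::real) - (z, 0)) = norm ((x - z) + r *\<^sub>R e n)"
        by (simp add: norm_Pair add_diff_eq diff_add_eq)
      also have "\<dots> = sqrt ((norm ((x - z) + r *\<^sub>R e n))\<^sup>2)" by simp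
      finally show ?thesis unfolding norm_sq_add_scaled[OF ne] .
    qed
    moreover have "norm ((x, r) - (z, 0)) = sqrt ((norm (x - z))\<^sup>2 + 2 * r * 0 + r\<^sup>2)"
      by (simp add: norm_Pair)
    ultimately show "(\<lambda>n. norm ((x + r *\<^sub>R e n, 0::real) - (z, 0)) - norm z) \<longlonglongrightarrow> norm ((x, r) - (z, 0)) - norm z"
      by (simp only:)
  qed
  then show ?thesis unfolding agree_kernel_iff .
qed

text \<open>Both measures have mass 1, so the leading terms \<open>norm p\<close> cancel and the
  difference grows more slowly than the norm.\<close>

lemma pdiff_eq_0_finite_dim:
  assumes B: "orthonormal_basis (B :: 'h set)" and bdry: "\<And>x. pdiff (x, 0) = 0" and r: "r \<ge> 0"
  shows "pdiff (x, r) = 0"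
proof -
  have growth: "\<exists>R. \<forall>p. norm p \<ge> R \<longrightarrow> \<bar>pdiff p\<bar> \<le> \<epsilon> * norm p" if \<epsilon>: "\<epsilon> > 0" for \<epsilon>
  proof -
    obtain R1 where R1: "\<And>p. norm p \<ge> R1 \<Longrightarrow> \<bar>pot P p - norm p\<bar> \<le> \<epsilon> / 2 * norm p"
      using pot_growth[OF prob_PQ(1) sets_P half_gt_zero[OF \<epsilon>]] by blast
    obtain R2 where R2: "\<And>p. norm p \<ge> R2 \<Longrightarrow> \<bar>pot Q p - norm p\<bar> \<le> \<epsilon> / 2 * norm p"
      using pot_growth[OF prob_PQ(2) sets_Q half_gt_zero[OF \<epsilon>]] by blast
    have "\<bar>pdiff p\<bar> \<le> \<epsilon> * norm p" if "norm p \<ge> max R1 R2" for p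
    proof -
      have "\<bar>pot P p - norm p\<bar> \<le> \<epsilon> / 2 * norm p" "\<bar>pot Q p - norm p\<bar> \<le> \<epsilon> / 2 * norm p"
        using R1[of p] R2[of p] that by simp_all
      then have "\<bar>pot P p - pot Q p\<bar> \<le> \<epsilon> / 2 * norm p + \<epsilon> / 2 * norm p" by linarith
      then show ?thesis by (simp add: pdiff_def)
    qed
    then show ?thesis by blast
  qed
  have diff: "disc_op B (\<lambda>p. a * pdiff p) p t = a * (disc_op B (pot P) p t + (- 1) * disc_op B (pot Q) p t)" for a p t
    unfolding disc_op_cmult[symmetric] disc_op_add[symmetric] pdiff_def by simp
  have harm: "(\<lambda>n. disc_op B (\<lambda>p. a * pdiff p) p (inverse (real (Suc n)))) \<longlonglongrightarrow> 0" if "snd p > 0" for a p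
    unfolding diff using disc_op_pot_tendsto[OF prob_PQ(1) sets_P B that] disc_op_pot_tendsto[OF prob_PQ(2) sets_Q B that]
    by (auto intro!: tendsto_eq_intros)
  \<comment> \<open>The maximum principle bounds from above only; both signs of \<open>a\<close> are
    needed.\<close>
  have "a * pdiff (x, r) \<le> 0" if "\<bar>a\<bar> = 1" for a
  proof (rule max_principle[OF B _ _ _ harm r])
    show "continuous_on UNIV (\<lambda>p. a * pdiff p)"
      by (intro continuous_intros continuous_on_pdiff)
    show "\<exists>R. \<forall>p. R \<le> norm p \<longrightarrow> a * pdiff p \<le> \<epsilon> * norm p" if "\<epsilon> > 0" for \<epsilon>
    proof -
      have "a * pdiff p \<le> \<bar>pdiff p\<bar>" for p
        using abs_ge_self[of "a * pdiff p"] \<open>\<bar>a\<bar> = 1\<close> by (simp add: abs_mult)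
      then show ?thesis using growth[OF that] by (meson order.trans)
    qed
  qed (simp_all add: bdry)
  from this[of 1] this[of "-1"] show ?thesis by simp
qed

lemma pdiff_eq_0:
  assumes "\<And>x. pdiff (x, 0) = 0" and "r \<ge> 0" shows "pdiff (x, r) = 0"
  using orthonormal_basis_or_sequence[where 'a = 'h] pdiff_eq_0_sequence pdiff_eq_0_finite_dim assms
  by metis

end

section \<open>Gaussians determine the measure\<close>

lemma powr_difference_quotient_tendsto:
  assumes "s > (0::real)"
  shows "(\<lambda>n. ((s + inverse (real (Suc n))) powr a - s powr a) * real (Suc n)) \<longlonglongrightarrow> a * s powr (a - 1)"
proof -
  have "((\<lambda>x. x powr a) has_real_derivative a * s powr (a - 1)) (at s)"
    using has_real_derivative_powr[OF assms] .
  then have "((\<lambda>h. ((s + h) powr a - s powr a) / h) \<longlongrightarrow> a * s powr (a - 1)) (at 0)"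
    by (simp add: DERIV_def)
  moreover have "filterlim (\<lambda>n. inverse (real (Suc n))) (at 0) sequentially"
    by (rule filterlim_atI[OF LIMSEQ_inverse_real_of_nat]) simp
  ultimately have "(\<lambda>n. ((s + inverse (real (Suc n))) powr a - s powr a) / inverse (real (Suc n))) \<longlonglongrightarrow> a * s powr (a - 1)"
    by (rule filterlim_compose)
  then show ?thesis by (simp add: divide_inverse)
qed

text \<open>For \<open>a \<le> 1\<close> the power in the derivative is nonincreasing, so its value
  at \<open>s\<close> bounds it for all arguments beyond \<open>s\<close>.\<close>

lemma powr_difference_quotient_bound:
  assumes "s > (0::real)" "h > 0" "a \<le> 1" "s \<le> y"
  shows "\<bar>((y + h) powr a - y powr a) / h\<bar> \<le> \<bar>a\<bar> * s powr (a - 1)"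
proof -
  have "\<exists>\<xi>>y. \<xi> < y + h \<and> (y + h) powr a - y powr a = (y + h - y) * (a * \<xi> powr (a - 1))"
    using assms by (intro MVT2 has_real_derivative_powr) auto
  then obtain \<xi> where \<xi>: "y < \<xi>" "(y + h) powr a - y powr a = h * (a * \<xi> powr (a - 1))" by auto
  have "\<xi> powr (a - 1) \<le> s powr (a - 1)"
    using assms \<xi> by (intro powr_mono2') auto
  then show ?thesis using \<xi> assms by (simp add: abs_mult mult_left_mono)
qed

text \<open>Up to a constant factor, the Gaussian centred at \<open>y / (2 * \<sigma>)\<close>. In
  this form a product just adds both parameters.\<close>

definition gauss :: "real \<Rightarrow> 'a::real_inner \<Rightarrow> 'a \<Rightarrow> real" where
  "gauss \<sigma> y z = exp (inner y z - \<sigma> * (norm z)\<^sup>2)"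

lemma gauss_mult: "gauss \<sigma> y z * gauss \<tau> x z = gauss (\<sigma> + \<tau>) (y + x) z"
  unfolding gauss_def exp_add[symmetric] by (simp add: inner_add_left algebra_simps)

lemma gauss_complete_square:
  assumes "\<sigma> > 0"
  shows "gauss \<sigma> y z = exp ((norm y)\<^sup>2 / (4 * \<sigma>)) * exp (- \<sigma> * (norm ((1 / (2 * \<sigma>)) *\<^sub>R y - z))\<^sup>2)"
proof -
  have square: "(norm ((1 / (2 * \<sigma>)) *\<^sub>R y - z))\<^sup>2 = (norm y)\<^sup>2 / (4 * \<sigma>\<^sup>2) - inner y z / \<sigma> + (norm z)\<^sup>2"
    unfolding power2_norm_eq_inner
    using assms by (simp add: inner_diff_left inner_diff_right inner_commute field_simps power2_eq_square)
  have "(norm y)\<^sup>2 / (4 * \<sigma>) + (- \<sigma> * (norm ((1 / (2 * \<sigma>)) *\<^sub>R y - z))\<^sup>2) = inner y z - \<sigma> * (norm z)\<^sup>2"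
    unfolding square using assms by (simp add: field_simps power2_eq_square)
  then show ?thesis by (simp add: gauss_def exp_add[symmetric])
qed

lemma gauss_bound:
  assumes "\<sigma> > 0" shows "\<bar>gauss \<sigma> y z\<bar> \<le> exp ((norm y)\<^sup>2 / (4 * \<sigma>))"
  unfolding gauss_complete_square[OF assms] using assms by (simp add: abs_mult mult_left_le)

section \<open>From potentials to Gaussian integrals\<close>

context borel_prob_pair
begin

text \<open>Difference quotients in \<open>s\<close> converge boundedly. Only differences are
  assumed to agree, since for \<open>a = 1/2\<close> the power itself need not be integrable without
  moments.\<close>

lemma agree_powr_deriv:
  fixes U :: "'h \<Rightarrow> real"
  assumes U: "\<And>z. U z \<ge> 0" and a: "a \<le> 1" "a \<noteq> 0"
    and ag: "\<And>s t. s > 0 \<Longrightarrow> t > 0 \<Longrightarrow> agree (\<lambda>z. (U z + t) powr a - (U z + s) powr a)"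
    and s: "s > 0"
  shows "agree (\<lambda>z. (U z + s) powr (a - 1))"
proof -
  have "agree (\<lambda>z. a * (U z + s) powr (a - 1))"
  proof (rule agree_limit)
    show "agree (\<lambda>z. real (Suc n) * ((U z + (s + inverse (real (Suc n)))) powr a - (U z + s) powr a))" for n
      using s by (intro agree_cmult ag add_pos_pos) auto
    show "\<bar>real (Suc n) * ((U z + (s + inverse (real (Suc n)))) powr a - (U z + s) powr a)\<bar> \<le> \<bar>a\<bar> * s powr (a - 1)" for n z
      using powr_difference_quotient_bound[OF s, of "inverse (real (Suc n))" a "U z + s"] U[of z] a(1)
      by (simp add: divide_inverse mult.commute add.assoc)
    show "(\<lambda>n. real (Suc n) * ((U z + (s + inverse (real (Suc n)))) powr a - (U z + s) powr a)) \<longlonglongrightarrow> a * (U z + s) powr (a - 1)" for z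
      using powr_difference_quotient_tendsto[of "U z + s" a] U[of z] s
      by (simp add: mult.commute add.assoc)
  qed
  from agree_cmult[OF this, of "inverse a"] a(2) show ?thesis by (simp flip: mult.assoc)
qed

lemma agree_powr_half_minus_nat:
  fixes U :: "'h \<Rightarrow> real"
  assumes U: "\<And>z. U z \<ge> 0"
    and ag: "\<And>s t. s > 0 \<Longrightarrow> t > 0 \<Longrightarrow> agree (\<lambda>z. sqrt (U z + t) - sqrt (U z + s))"
    and s: "s > 0"
  shows "agree (\<lambda>z. (U z + s) powr (- 1 / 2 - real k))"
  using s
proof (induction k arbitrary: s)
  case 0
  have "agree (\<lambda>z. (U z + t) powr (1/2) - (U z + s) powr (1/2))" if "s > 0" "t > 0" for s t
    using ag[OF that] U that by (simp add: powr_half_sqrt add_nonneg_nonneg less_imp_le)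
  from agree_powr_deriv[OF U _ _ this 0] show ?case by simp
next
  case (Suc k)
  \<comment> \<open>From the first derivative on, the powers themselves agree, hence so do their
    differences.\<close>
  have "agree (\<lambda>z. (U z + s) powr (- 1 / 2 - real k - 1))"
  proof (rule agree_powr_deriv[OF U _ _ _ Suc.prems])
    show "agree (\<lambda>z. (U z + t) powr (- 1 / 2 - real k) - (U z + s) powr (- 1 / 2 - real k))"
      if "s > 0" "t > 0" for s t
      by (intro agree_diff Suc.IH that)
  qed auto
  then show ?case by (simp add: algebra_simps)
qed

lemma agree_exp:
  fixes U :: "'h \<Rightarrow> real"
  assumes U: "\<And>z. U z \<ge> 0"
    and ag: "\<And>s t. s > 0 \<Longrightarrow> t > 0 \<Longrightarrow> agree (\<lambda>z. sqrt (U z + t) - sqrt (U z + s))"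
    and \<sigma>: "\<sigma> > 0"
  shows "agree (\<lambda>z. exp (- \<sigma> * U z))"
proof (rule agree_limit)
  \<comment> \<open>At this \<open>s\<close>, multiplying by \<open>s n powr (1/2 + n)\<close>
    normalises the power to base \<open>1 + \<sigma> * U z / (n + 1)\<close>, which is bounded by 1
    and tends to the exponential.\<close>
  define s where "s n = real (Suc n) / \<sigma>" for n
  have s: "s n > 0" for n using \<sigma> by (simp add: s_def)
  have eq: "s n powr (1 / 2 + real n) * (U z + s n) powr (- 1 / 2 - real n) = (1 + \<sigma> * U z / real (Suc n)) powr (- 1 / 2 - real n)" for n z
  proof -
    have "s n * (\<sigma> * U z / real (Suc n)) = U z"
      using \<sigma> by (simp add: s_def del: of_nat_Suc)
    then have "U z + s n = s n * (1 + \<sigma> * U z / real (Suc n))"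
      unfolding distrib_left by simp
    then have "(U z + s n) powr (- 1 / 2 - real n) = s n powr (- 1 / 2 - real n) * (1 + \<sigma> * U z / real (Suc n)) powr (- 1 / 2 - real n)"
      using s[of n] U[of z] \<sigma> by (simp add: powr_mult)
    moreover have "s n powr (1 / 2 + real n) * s n powr (- 1 / 2 - real n) = 1"
      using s[of n] by (simp flip: powr_add)
    ultimately show ?thesis by (simp flip: mult.assoc)
  qed
  show "agree (\<lambda>z. (1 + \<sigma> * U z / real (Suc n)) powr (- 1 / 2 - real n))" for n
    unfolding eq[symmetric] by (intro agree_cmult agree_powr_half_minus_nat[OF U ag s])
  show "\<bar>(1 + \<sigma> * U z / real (Suc n)) powr (- 1 / 2 - real n)\<bar> \<le> 1" for n z
  proof -
    have "(1 + \<sigma> * U z / real (Suc n)) powr (- 1 / 2 - real n) \<le> 1 powr (- 1 / 2 - real n)"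
      using U[of z] \<sigma> by (intro powr_mono2') auto
    then show ?thesis by simp
  qed
  show "(\<lambda>n. (1 + \<sigma> * U z / real (Suc n)) powr (- 1 / 2 - real n)) \<longlonglongrightarrow> exp (- \<sigma> * U z)" for z
  proof -
    define y where "y = \<sigma> * U z"
    have "y \<ge> 0" using U[of z] \<sigma> by (simp add: y_def)
    then have "y = 0 \<or> y > 0" by auto
    then have "(\<lambda>n. (1 + y / real (Suc n)) powr (- 1 / 2 - real n)) \<longlonglongrightarrow> exp (- y)"
    proof
      assume "y > 0" then show ?thesis by real_asymp
    qed simp
    then show ?thesis by (simp add: y_def)
  qed
qed

lemma agree_gauss:
  assumes z: "\<And>x r. r \<ge> 0 \<Longrightarrow> pdiff (x, r) = 0" and "\<sigma> > 0"
  shows "agree (gauss \<sigma> y)"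
proof -
  have "agree (\<lambda>z. sqrt ((norm (x - z))\<^sup>2 + t) - sqrt ((norm (x - z))\<^sup>2 + s))" if "s > 0" "t > 0" for x s t
  proof -
    \<comment> \<open>Subtracting kernels at two heights cancels \<open>norm z\<close> and leaves
      the differences of square roots.\<close>
    have "agree (\<lambda>z. norm ((x, sqrt t) - (z, 0)) - norm z - (norm ((x, sqrt s) - (z, 0)) - norm z))"
      using that by (intro agree_diff[OF agree_kernel_iff[THEN iffD2] agree_kernel_iff[THEN iffD2]] z) simp_all
    then show ?thesis using that by (simp add: norm_Pair)
  qed
  then have "agree (\<lambda>z. exp (- \<sigma> * (norm ((1 / (2 * \<sigma>)) *\<^sub>R y - z))\<^sup>2))"
    using \<open>\<sigma> > 0\<close> by (intro agree_exp) auto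
  then show ?thesis
    unfolding gauss_complete_square[OF \<open>\<sigma> > 0\<close>, abs_def] by (rule agree_cmult)
qed

text \<open>Bounded functions that integrate to the same value against every Gaussian. Since Gaussians are
  closed under products, this class is stable under multiplication by Gaussians, hence by continuous
  functions of a Gaussian (Weierstrass), hence by indicators of balls.\<close>

definition gauss_agree :: "('h \<Rightarrow> real) \<Rightarrow> bool" where
  "gauss_agree g \<longleftrightarrow> (\<exists>C. \<forall>z. \<bar>g z\<bar> \<le> C) \<and> (\<forall>\<sigma>>0. \<forall>y. agree (\<lambda>z. g z * gauss \<sigma> y z))"

lemma gauss_agreeD: "gauss_agree g \<Longrightarrow> \<sigma> > 0 \<Longrightarrow> agree (\<lambda>z. g z * gauss \<sigma> y z)"
  by (simp add: gauss_agree_def)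

lemma gauss_agree_cmult: "gauss_agree g \<Longrightarrow> gauss_agree (\<lambda>z. c * g z)"
proof -
  assume g: "gauss_agree g"
  then obtain C where C: "\<And>z. \<bar>g z\<bar> \<le> C" by (auto simp: gauss_agree_def)
  have "\<bar>c * g z\<bar> \<le> \<bar>c\<bar> * C" for z using C by (simp add: abs_mult mult_left_mono)
  moreover have "agree (\<lambda>z. c * g z * gauss \<sigma> y z)" if "\<sigma> > 0" for \<sigma> y
    using agree_cmult[OF gauss_agreeD[OF g that]] by (simp add: mult.assoc)
  ultimately show ?thesis by (auto simp: gauss_agree_def)
qed

lemma gauss_agree_add:
  assumes g: "gauss_agree g" and h: "gauss_agree h" shows "gauss_agree (\<lambda>z. g z + h z)"
proof -
  obtain C D where C: "\<And>z. \<bar>g z\<bar> \<le> C" "\<And>z. \<bar>h z\<bar> \<le> D" using g h by (auto simp: gauss_agree_def)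
  have "\<bar>g z + h z\<bar> \<le> C + D" for z using C[of z] by linarith
  moreover have "agree (\<lambda>z. (g z + h z) * gauss \<sigma> y z)" if "\<sigma> > 0" for \<sigma> y
    using agree_add[OF gauss_agreeD[OF g that] gauss_agreeD[OF h that]] by (simp add: distrib_right)
  ultimately show ?thesis by (auto simp: gauss_agree_def)
qed

lemma gauss_agree_diff: "gauss_agree g \<Longrightarrow> gauss_agree h \<Longrightarrow> gauss_agree (\<lambda>z. g z - h z)"
  using gauss_agree_add[of g "\<lambda>z. (- 1) * h z"] gauss_agree_cmult[of h "- 1"] by simp

lemma gauss_agree_limit:
  assumes g: "\<And>n. gauss_agree (g n)" and C: "\<And>n z. \<bar>g n z\<bar> \<le> C" and lim: "\<And>z. (\<lambda>n. g n z) \<longlonglongrightarrow> h z"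
  shows "gauss_agree h"
proof -
  have C0: "C \<ge> 0" using C[of 0 0] by linarith
  have "\<bar>h z\<bar> \<le> C" for z
    by (rule LIMSEQ_le_const2[OF tendsto_rabs[OF lim]]) (use C in auto)
  moreover have "agree (\<lambda>z. h z * gauss \<sigma> y z)" if "\<sigma> > 0" for \<sigma> y
  proof (rule agree_limit[where f = "\<lambda>n z. g n z * gauss \<sigma> y z" and C = "C * exp ((norm y)\<^sup>2 / (4 * \<sigma>))"])
    show "\<bar>g n z * gauss \<sigma> y z\<bar> \<le> C * exp ((norm y)\<^sup>2 / (4 * \<sigma>))" for n z
      unfolding abs_mult using C C0 gauss_bound[OF that] by (intro mult_mono) auto
    show "(\<lambda>n. g n z * gauss \<sigma> y z) \<longlonglongrightarrow> h z * gauss \<sigma> y z" for z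
      by (intro tendsto_intros lim)
  qed (rule gauss_agreeD[OF g that])
  ultimately show ?thesis by (auto simp: gauss_agree_def)
qed

lemma gauss_agree_mult_gauss:
  assumes g: "gauss_agree g" and \<tau>: "\<tau> > 0" shows "gauss_agree (\<lambda>z. g z * gauss \<tau> x z)"
proof -
  obtain C where C: "\<And>z. \<bar>g z\<bar> \<le> C" using g by (auto simp: gauss_agree_def)
  have C0: "C \<ge> 0" using C[of 0] by linarith
  have "\<bar>g z * gauss \<tau> x z\<bar> \<le> C * exp ((norm x)\<^sup>2 / (4 * \<tau>))" for z
    unfolding abs_mult using C C0 gauss_bound[OF \<tau>] by (intro mult_mono) auto
  moreover have "agree (\<lambda>z. g z * gauss \<tau> x z * gauss \<sigma> y z)" if "\<sigma> > 0" for \<sigma> y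
    using gauss_agreeD[OF g, of "\<tau> + \<sigma>" "x + y"] \<tau> that by (simp add: mult.assoc gauss_mult)
  ultimately show ?thesis by (auto simp: gauss_agree_def)
qed

lemma gauss_agree_mult_ball:
  assumes g: "gauss_agree g" shows "gauss_agree (\<lambda>z. g z * indicator (ball x r) z)"
proof (cases "r > 0")
  case False
  then have empty: "ball x r = {}" by simp
  show ?thesis unfolding empty using gauss_agree_cmult[OF g, of 0] by simp
next
  case r: True
  define f where "f z = exp (- 1 * (norm (x - z))\<^sup>2)" for z
  have f: "f z \<in> {0..1}" for z by (simp add: f_def)
  have fg: "f z = exp (- (norm x)\<^sup>2) * gauss 1 (2 *\<^sub>R x) z" for z
    using gauss_complete_square[of 1 "2 *\<^sub>R x" z] by (simp add: f_def exp_minus)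
  have mf: "gauss_agree (\<lambda>z. h z * f z)" if "gauss_agree h" for h
    using gauss_agree_cmult[OF gauss_agree_mult_gauss[OF that, of 1 "2 *\<^sub>R x"], of "exp (- (norm x)\<^sup>2)"]
    by (simp add: fg mult.left_commute)
  \<comment> \<open>Keeping \<open>h\<close> arbitrary lets the product case multiply by one factor
    and then by the other.\<close>
  have poly: "gauss_agree (\<lambda>z. h z * p (f z))" if "real_polynomial_function p" "gauss_agree h" for p h
    using that
  proof (induction p arbitrary: h rule: real_polynomial_function.induct)
    case (linear q)
    have q: "q t = t * q 1" for t using linear_scale[OF bounded_linear.linear[OF linear(1)], of t 1] by simp
    have "(\<lambda>z. h z * q (f z)) = (\<lambda>z. q 1 * (h z * f z))" by (rule ext) (subst q, simp)
    then show ?case using gauss_agree_cmult[OF mf[OF linear(2)]] by simp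
  next
    case (const c)
    then show ?case using gauss_agree_cmult[of h c] by (simp add: mult.commute)
  next
    case (add p q)
    then show ?case using gauss_agree_add by (simp add: distrib_left)
  next
    case (mult p q)
    then show ?case using mult.IH(2)[OF mult.IH(1)[OF mult.prems]] by (simp add: mult.assoc)
  qed
  \<comment> \<open>The ball is the set where \<open>f z > a\<close>. The ramps vanish up to
    \<open>a\<close> and tend to 1 beyond it, so the sphere is excluded.\<close>
  define a where "a = exp (- r\<^sup>2)"
  define ramp where "ramp n t = max 0 (min 1 (real n * (t - a)))" for n t
  have ex: "\<exists>p. real_polynomial_function p \<and> (\<forall>t\<in>{0..1}. \<bar>ramp n t - p t\<bar> < inverse (real (Suc n)))" for n
  proof -
    have "continuous_on {0..1} (ramp n)" unfolding ramp_def by (intro continuous_intros)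
    from Stone_Weierstrass_real_polynomial_function[OF compact_Icc this, of "inverse (real (Suc n))"]
    show ?thesis by (metis inverse_positive_iff_positive of_nat_0_less_iff zero_less_Suc)
  qed
  obtain p where p: "\<And>n. real_polynomial_function (p n)"
    "\<And>n t. t \<in> {0..1} \<Longrightarrow> \<bar>ramp n t - p n t\<bar> < inverse (real (Suc n))"
    using ex by metis
  obtain C where C: "\<And>z. \<bar>g z\<bar> \<le> C" using g by (auto simp: gauss_agree_def)
  have C0: "C \<ge> 0" using C[of 0] by linarith
  have ramp_lim: "(\<lambda>n. ramp n t) \<longlonglongrightarrow> indicator {a<..} t" for t
  proof (cases "t > a")
    case True
    have "\<forall>\<^sub>F n in sequentially. real n \<ge> 1 / (t - a)" by real_asymp
    then have "\<forall>\<^sub>F n in sequentially. ramp n t = indicator {a<..} t"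
      by eventually_elim (use True in \<open>auto simp: ramp_def field_simps\<close>)
    then show ?thesis by (rule tendsto_eventually)
  next
    case False
    then have "real n * (t - a) \<le> 0" for n by (simp add: mult_nonneg_nonpos)
    then have "ramp n t = 0" for n unfolding ramp_def by (simp add: min.coboundedI2 max_absorb1)
    then show ?thesis using False by simp
  qed
  show ?thesis
  proof (rule gauss_agree_limit[where C = "C * 2"])
    show "gauss_agree (\<lambda>z. g z * p n (f z))" for n by (rule poly[OF p(1) g])
    show "\<bar>g z * p n (f z)\<bar> \<le> C * 2" for n z
    proof -
      have "\<bar>ramp n (f z)\<bar> \<le> 1" by (simp add: ramp_def)
      moreover have "inverse (real (Suc n)) \<le> 1" by (simp add: inverse_le_1_iff)
      ultimately have "\<bar>p n (f z)\<bar> \<le> 2" using p(2)[OF f, of n z] by linarith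
      then show ?thesis unfolding abs_mult using C C0 by (intro mult_mono) auto
    qed
    show "(\<lambda>n. g z * p n (f z)) \<longlonglongrightarrow> g z * indicator (ball x r) z" for z
    proof (intro tendsto_intros)
      have "(\<lambda>n. ramp n (f z) - p n (f z)) \<longlonglongrightarrow> 0"
        by (rule Lim_null_comparison[OF _ LIMSEQ_inverse_real_of_nat]) (use p(2)[OF f] in \<open>auto intro!: always_eventually less_imp_le\<close>)
      from tendsto_diff[OF ramp_lim[of "f z"] this]
      have "(\<lambda>n. p n (f z)) \<longlonglongrightarrow> indicator {a<..} (f z)" by simp
      moreover have "f z > a \<longleftrightarrow> (norm (x - z))\<^sup>2 < r\<^sup>2"
        by (simp add: f_def a_def)
      moreover have "(norm (x - z))\<^sup>2 < r\<^sup>2 \<longleftrightarrow> z \<in> ball x r"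
        using r power_strict_mono[of "norm (x - z)" r 2] power2_less_imp_less[of "norm (x - z)" r]
        unfolding mem_ball dist_norm by (meson less_imp_le norm_ge_zero zero_less_numeral)
      ultimately show "(\<lambda>n. p n (f z)) \<longlonglongrightarrow> indicator (ball x r) z"
        by (simp add: indicator_def)
    qed
  qed
qed

text \<open>Stability for every \<open>g\<close> can be iterated, which gives closure under
  intersection. The stable sets thus form a sigma-algebra, and balls suffice as a start although
  they are not closed under intersection.\<close>

definition gauss_stable :: "'h set \<Rightarrow> bool" where
  "gauss_stable A \<longleftrightarrow> (\<forall>g. gauss_agree g \<longrightarrow> gauss_agree (\<lambda>z. g z * indicator A z))"

lemma gauss_stable_empty: "gauss_stable {}"
  using gauss_agree_cmult[of _ 0] by (simp add: gauss_stable_def)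

lemma gauss_stable_Compl: "gauss_stable A \<Longrightarrow> gauss_stable (- A)"
proof -
  assume A: "gauss_stable A"
  have "(\<lambda>z. g z * indicator (- A) z) = (\<lambda>z. g z - g z * indicator A z :: real)" for g :: "'h \<Rightarrow> real"
    by (auto simp: indicator_def)
  then show ?thesis using A gauss_agree_diff by (simp add: gauss_stable_def)
qed

lemma gauss_stable_Un:
  assumes A: "gauss_stable A" and B: "gauss_stable B" shows "gauss_stable (A \<union> B)"
proof -
  have "gauss_stable (- A \<inter> - B)"
    unfolding gauss_stable_def
  proof (intro allI impI)
    fix g :: "'h \<Rightarrow> real" assume "gauss_agree g"
    then have "gauss_agree (\<lambda>z. g z * indicator (- A) z * indicator (- B) z)"
      using gauss_stable_Compl[OF A] gauss_stable_Compl[OF B] by (simp add: gauss_stable_def)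
    then show "gauss_agree (\<lambda>z. g z * indicator (- A \<inter> - B) z)"
      by (simp add: indicator_inter_arith mult.assoc)
  qed
  from gauss_stable_Compl[OF this] show ?thesis by (simp add: Compl_Int)
qed

lemma gauss_stable_UN:
  fixes A :: "nat \<Rightarrow> 'h set"
  assumes A: "\<And>i. gauss_stable (A i)" shows "gauss_stable (\<Union>i. A i)"
  unfolding gauss_stable_def
proof (intro allI impI)
  fix g :: "'h \<Rightarrow> real" assume g: "gauss_agree g"
  then obtain C where C: "\<And>z. \<bar>g z\<bar> \<le> C" by (auto simp: gauss_agree_def)
  have fin: "gauss_stable (\<Union>i<n. A i)" for n
    by (induction n) (auto simp: lessThan_Suc intro: gauss_stable_empty gauss_stable_Un A)
  show "gauss_agree (\<lambda>z. g z * indicator (\<Union>i. A i) z)"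
  proof (rule gauss_agree_limit)
    show "gauss_agree (\<lambda>z. g z * indicator (\<Union>i<n. A i) z)" for n
      using fin g by (simp add: gauss_stable_def)
    show "\<bar>g z * indicator (\<Union>i<n. A i) z\<bar> \<le> C" for n z
      using C[of z] by (auto simp: indicator_def)
    show "(\<lambda>n. g z * indicator (\<Union>i<n. A i) z) \<longlonglongrightarrow> g z * indicator (\<Union>i. A i) z" for z
      by (intro tendsto_intros LIMSEQ_indicator_UN)
  qed
qed

lemma gauss_stable_borel:
  assumes "A \<in> sets borel" shows "gauss_stable A"
proof -
  have op: "gauss_stable S" if S: "open S" for S
  proof -
    \<comment> \<open>Second countability reduces the cover of \<open>S\<close> by balls to a
      countable one.\<close>
    define F where "F = {ball x r |x r. ball x r \<subseteq> S}"
    obtain F' where F': "F' \<subseteq> F" "countable F'" "\<Union>F' = \<Union>F"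
      by (rule Lindelof[of F]) (auto simp: F_def)
    have "\<Union>F = S"
      using S unfolding F_def by (auto simp: open_contains_ball) (metis centre_in_ball)
    show ?thesis
    proof (cases "F' = {}")
      case True
      then show ?thesis using F' \<open>\<Union>F = S\<close> gauss_stable_empty by simp
    next
      case False
      have "gauss_stable (\<Union>i. from_nat_into F' i)"
      proof (rule gauss_stable_UN)
        fix i
        have "from_nat_into F' i \<in> F" using from_nat_into[OF False] F'(1) by blast
        then show "gauss_stable (from_nat_into F' i)"
          using gauss_agree_mult_ball by (auto simp: F_def gauss_stable_def)
      qed
      moreover have "(\<Union>i. from_nat_into F' i) = S"
        using range_from_nat_into[OF False F'(2)] F'(3) \<open>\<Union>F = S\<close> by simp
      ultimately show ?thesis by simp
    qed
  qed
  from assms have "A \<in> sigma_sets UNIV {S. open S}" by (simp add: borel_def)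
  then show ?thesis
    by induction (auto intro: op gauss_stable_empty gauss_stable_Compl gauss_stable_UN simp flip: Compl_eq_Diff_UNIV)
qed

lemma eq_if_pdiff_eq_0:
  assumes "\<And>x r. r \<ge> 0 \<Longrightarrow> pdiff (x, r) = 0" shows "P = Q"
proof (rule measure_eqI)
  show "sets P = sets Q" by (simp add: sets_P sets_Q)
  fix A assume "A \<in> sets P"
  then have A: "A \<in> sets borel" by (simp add: sets_P)
  have "gauss_agree (\<lambda>_. 1)"
    using agree_gauss[OF assms] by (auto simp: gauss_agree_def intro!: exI[of _ 1])
  then have "gauss_agree (\<lambda>z. 1 * indicator A z)"
    using gauss_stable_borel[OF A] unfolding gauss_stable_def by blast
  then have ag: "agree (\<lambda>z. indicator A z * gauss \<sigma> 0 z)" if "\<sigma> > 0" for \<sigma>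
    using gauss_agreeD that by fastforce
  \<comment> \<open>The Gaussian factor is removed by letting its width tend to infinity, where it
    tends to 1.\<close>
  have "agree (indicator A)"
  proof (rule agree_limit)
    show "agree (\<lambda>z. indicator A z * gauss (inverse (real (Suc n))) 0 z)" for n by (rule ag) simp
    show "\<bar>indicator A z * gauss (inverse (real (Suc n))) 0 z\<bar> \<le> 1" for n z
      by (auto simp: gauss_def indicator_def)
    show "(\<lambda>n. indicator A z * gauss (inverse (real (Suc n))) 0 z) \<longlonglongrightarrow> indicator A z" for z
    proof -
      have "(\<lambda>n. indicator A z * exp (0 - inverse (real (Suc n)) * (norm z)\<^sup>2)) \<longlonglongrightarrow> indicator A z * exp (0 - 0 * (norm z)\<^sup>2)"
        by (intro tendsto_intros LIMSEQ_inverse_real_of_nat)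
      then show ?thesis by (simp add: gauss_def)
    qed
  qed
  then have "measure P A = measure Q A" by (simp add: agree_def)
  then show "emeasure P A = emeasure Q A"
    by (simp add: P.emeasure_eq_measure Q.emeasure_eq_measure)
qed

end

theorem theorem1p1:
  fixes P Q :: "'h::{real_inner, banach, second_countable_topology} measure"
  assumes "prob_space P" and "sets P = sets borel"
    and "prob_space Q" and "sets Q = sets borel"
  shows "((\<forall>x. spatial_df P x = spatial_df Q x) \<longrightarrow> P = Q) \<and>
    (\<forall>D. closure D = UNIV \<longrightarrow> (\<forall>x\<in>D. spatial_df P x = spatial_df Q x) \<longrightarrow> P = Q)"
proof -
  interpret borel_prob_pair P Q
    by (intro borel_prob_pair.intro borel_prob_pair_axioms.intro assms)
  have dense: "P = Q" if "closure D = UNIV" "\<forall>x\<in>D. spatial_df P x = spatial_df Q x" for D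
  proof -
    have "pdiff (x, 0) = 0" for x
      using that by (intro pdiff_boundary_eq_0) auto
    from eq_if_pdiff_eq_0[OF pdiff_eq_0[OF this]] show ?thesis .
  qed
  then show ?thesis using dense[of UNIV] by auto
qed

end
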